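(* For each $n$ let $X=X^{(n)}$ be a uniformly distributed $n\times n$ doubly stochastic matrix. Let $k=k(n)$ be a sequence of positive integers with $k(n)\le n$ and $k(n)=O\bigl(\frac{\sqrt n}{\log n}\bigr)$ as $n\to\infty$. Let $V=V^{(n)}$ be the $k\times k$ submatrix of $X$ formed by its first $k$ rows and first $k$ columns, and let $\Delta=\Delta^{(n)}$ be a $k\times k$ matrix of independent exponential random variables with mean $1$. Then \[ d_{\mathrm{tv}}(nV,\Delta)\to 0\quad\text{as } n\to\infty . \]
   Context: A doubly stochastic matrix is an $n\times n$ matrix with nonnegative real entries all of whose row sums and column sums equal $1$; the set of these, the Birkhoff polytope, is an $(n-1)^2$-dimensional polytope. "Uniformly distributed" means distributed according to normalized $(n-1)^2$-dimensional Lebesgue measure on this polytope; equivalently, the entries $(X_{ij})_{1\le i,j\le n-1}$ are uniform (normalized Lebesgue measure on $\mathbb{R}^{(n-1)^2}$) on the set of $(n-1)\times(n-1)$ matrices that are the upper-left block of some doubly stochastic $n\times n$ matrix. $d_{\mathrm{tv}}$ denotes total variation distance between the laws of the random matrices on $\mathbb{R}^{k\times k}$, $d_{\mathrm{tv}}(\mu,\nu)=\sup_A|\mu(A)-\nu(A)|$ over Borel sets $A$. *)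

theory Defs
  imports "HOL-Probability.Probability" "HOL-Library.Landau_Symbols"
begin

text \<open>
  Real \<open>n \<times> n\<close> matrices are functions on index pairs, extensional (that is, \<open>undefined\<close>) outside
  \<open>matrix_index n\<close>, so that they are the points of the finite product spaces
  \<open>PiM (matrix_index n) (\<lambda>_. borel)\<close>. Rows and columns are numbered from \<open>0\<close>. The product
  sigma-algebra is the Borel sigma-algebra of \<open>n \<times> n\<close>-dimensional space.
\<close>

definition matrix_index :: "nat \<Rightarrow> (nat \<times> nat) set" where
  "matrix_index n = {..<n} \<times> {..<n}"

abbreviation matrix_borel :: "nat \<Rightarrow> (nat \<times> nat \<Rightarrow> real) measure" where
  "matrix_borel n \<equiv> PiM (matrix_index n) (\<lambda>_. borel)"

abbreviation matrix_lborel :: "nat \<Rightarrow> (nat \<times> nat \<Rightarrow> real) measure" where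
  "matrix_lborel n \<equiv> PiM (matrix_index n) (\<lambda>_. lborel)"

definition upper_left_block :: "nat \<Rightarrow> (nat \<times> nat \<Rightarrow> real) \<Rightarrow> nat \<times> nat \<Rightarrow> real" where
  "upper_left_block k A = restrict A (matrix_index k)"

definition birkhoff_polytope :: "nat \<Rightarrow> (nat \<times> nat \<Rightarrow> real) set" where
  "birkhoff_polytope n = {A \<in> extensional (matrix_index n).
     (\<forall>i<n. \<forall>j<n. 0 \<le> A (i, j)) \<and>
     (\<forall>i<n. (\<Sum>j<n. A (i, j)) = 1) \<and>
     (\<forall>j<n. (\<Sum>i<n. A (i, j)) = 1)}"

text \<open>
  The Birkhoff polytope has dimension \<open>(n - 1)\<^sup>2\<close>, and a doubly stochastic matrix is determined by
  its upper-left \<open>(n - 1) \<times> (n - 1)\<close> block; normalized Lebesgue measure on the polytope is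
  expressed in these coordinates. For \<open>n = 1\<close> the block is empty and \<open>matrix_lborel 0\<close> is a unit
  point mass.
\<close>

definition uniform_doubly_stochastic ::
    "nat \<Rightarrow> 'a measure \<Rightarrow> ('a \<Rightarrow> nat \<times> nat \<Rightarrow> real) \<Rightarrow> bool" where
  "uniform_doubly_stochastic n M X \<longleftrightarrow>
     prob_space M \<and>
     X \<in> measurable M (matrix_borel n) \<and>
     (AE \<omega> in M. X \<omega> \<in> birkhoff_polytope n) \<and>
     distr M (matrix_lborel (n - 1)) (\<lambda>\<omega>. upper_left_block (n - 1) (X \<omega>)) =
       uniform_measure (matrix_lborel (n - 1)) (upper_left_block (n - 1) ` birkhoff_polytope n)"

definition iid_exponential_matrix ::
    "nat \<Rightarrow> 'a measure \<Rightarrow> ('a \<Rightarrow> nat \<times> nat \<Rightarrow> real) \<Rightarrow> bool" where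
  "iid_exponential_matrix k M D \<longleftrightarrow>
     prob_space M \<and>
     D \<in> measurable M (matrix_borel k) \<and>
     prob_space.indep_vars M (\<lambda>_. borel) (\<lambda>ij \<omega>. D \<omega> ij) (matrix_index k) \<and>
     (\<forall>ij\<in>matrix_index k. distributed M lborel (\<lambda>\<omega>. D \<omega> ij) (exponential_density 1))"

definition scale_matrix :: "nat \<Rightarrow> real \<Rightarrow> (nat \<times> nat \<Rightarrow> real) \<Rightarrow> nat \<times> nat \<Rightarrow> real" where
  "scale_matrix k c A = (\<lambda>ij\<in>matrix_index k. c * A ij)"

text \<open>Intended for probability measures on the same sigma-algebra, where the supremum is over a
  set of reals bounded by \<open>1\<close>.\<close>

definition tv_dist :: "'a measure \<Rightarrow> 'a measure \<Rightarrow> real" where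
  "tv_dist \<mu> \<nu> = (SUP A\<in>sets \<mu>. \<bar>measure \<mu> A - measure \<nu> A\<bar>)"

end

theory Submission
  imports Defs "HOL-Real_Asymp.Real_Asymp"
begin

text \<open>
  Put \<open>m = n - 1\<close>. On the polytope of upper-left \<open>m \<times> m\<close> blocks of doubly stochastic matrices the
  density of independent exponential entries of rate \<open>n\<close> is at least \<open>n\<^bsup>m\<^sup>2\<^esup> exp (- n m)\<close>, so a lower
  bound for the volume of the polytope shows that the uniform law is at most \<open>exp (O(n ln n))\<close> times
  the exponential law. Under the latter, the indicators of an event for the \<open>(m div k)\<^sup>2\<close> disjoint
  \<open>k \<times> k\<close> blocks are independent, so by Hoeffding their average deviates from its mean by \<open>\<epsilon>\<close> with
  probability at most \<open>2 exp (- 2 \<epsilon>\<^sup>2 (m div k)\<^sup>2)\<close>. For \<open>k = O(sqrt n / ln n)\<close> this beats the factor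
  \<open>exp (O(n ln n))\<close>, hence the deviation is unlikely under the uniform law too; there all blocks have
  the same law by exchangeability, and so the average has the corner block's probability as its mean.

  For the volume, matrices whose row sums lie in a short interval just below \<open>m / n\<close> have an explicit
  volume, a power of a difference of simplex volumes. Sort them by the integer vector \<open>c\<close> of their
  column sums multiplied by \<open>n\<close> and rounded up, which has at most \<open>(m\<^sup>2 + 1)\<^sup>m\<close> values and total at most
  \<open>m n\<close>. Moving a unit from a column bound above \<open>n\<close> to one below \<open>n\<close> does not decrease the volume of
  the matrices with column sums at most \<open>c j / n\<close>: for fixed row-wise sums of two columns, the volume
  is unimodal in how the bound is divided between them. So the constant vector \<open>n\<close> gives the largest
  volume, and the matrices belonging to it lie in the polytope.
\<close>


subsection \<open>Balancing two column sums\<close>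

text \<open>On each line of constant \<open>u + v\<close> the value is governed by the distance to
  the diagonal and does not increase with it. Symmetry in the two arguments is included, since equal
  gaps give the inequality both ways.\<close>

definition antidiagonal_unimodal :: "(real \<Rightarrow> real \<Rightarrow> ennreal) \<Rightarrow> bool" where
  "antidiagonal_unimodal \<phi> \<longleftrightarrow>
     (\<forall>u v u' v'. u + v = u' + v' \<longrightarrow> \<bar>u' - v'\<bar> \<le> \<bar>u - v\<bar> \<longrightarrow> \<phi> u v \<le> \<phi> u' v')"

lemma antidiagonal_unimodalD:
  "antidiagonal_unimodal \<phi> \<Longrightarrow> u + v = u' + v' \<Longrightarrow> \<bar>u' - v'\<bar> \<le> \<bar>u - v\<bar> \<Longrightarrow> \<phi> u v \<le> \<phi> u' v'"
  unfolding antidiagonal_unimodal_def by blast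

text \<open>With \<open>\<phi> u v\<close> the volume of the admissible pairs of columns having sums at most \<open>u\<close> and \<open>v\<close>,
  this adds one more row, whose two entries have their sum constrained to \<open>T\<close>.\<close>

definition split_integral :: "real set \<Rightarrow> (real \<Rightarrow> real \<Rightarrow> ennreal) \<Rightarrow> real \<Rightarrow> real \<Rightarrow> ennreal" where
  "split_integral T \<phi> u v =
     (\<integral>\<^sup>+x. \<integral>\<^sup>+y. indicator {0..} x * indicator {0..} y * indicator T (x + y) * \<phi> (u - x) (v - y)
        \<partial>lborel \<partial>lborel)"

lemma measurable_split_integral:
  assumes [measurable]: "(\<lambda>p. \<phi> (fst p) (snd p)) \<in> borel_measurable (borel \<Otimes>\<^sub>M borel)"
    and [measurable]: "T \<in> sets borel"
  shows "(\<lambda>p. split_integral T \<phi> (fst p) (snd p)) \<in> borel_measurable (borel \<Otimes>\<^sub>M borel)"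
proof -
  have [measurable]: "(\<lambda>w. \<phi> (f w) (g w)) \<in> borel_measurable M"
    if [measurable]: "f \<in> borel_measurable M" "g \<in> borel_measurable M" for M :: "'z measure" and f g
    using measurable_compose[OF _ assms(1), of "\<lambda>w. (f w, g w)" M] by simp
  show ?thesis
    unfolding split_integral_def by measurable
qed

lemma nn_integral_lborel_pair_swap:
  fixes h :: "real \<Rightarrow> real \<Rightarrow> ennreal"
  assumes [measurable]: "(\<lambda>(x, y). h x y) \<in> borel_measurable (borel \<Otimes>\<^sub>M borel)"
  shows "(\<integral>\<^sup>+x. \<integral>\<^sup>+y. h x y \<partial>lborel \<partial>lborel) = (\<integral>\<^sup>+x. \<integral>\<^sup>+y. h y x \<partial>lborel \<partial>lborel)"
  by (rule lborel_pair.Fubini'[symmetric]) measurable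

lemma nn_integral_lborel_shift:
  fixes f :: "real \<Rightarrow> ennreal"
  assumes "f \<in> borel_measurable borel"
  shows "(\<integral>\<^sup>+x. f x \<partial>lborel) = (\<integral>\<^sup>+x. f (x + \<delta>) \<partial>lborel)"
  using nn_integral_real_affine[OF assms, of 1 \<delta>] by (simp add: add.commute)

text \<open>The integrals at \<open>(u, v)\<close> and \<open>(u - \<delta>, v + \<delta>)\<close> agree, after translation, except for the parts
  \<open>x < \<delta>\<close> and \<open>y < \<delta>\<close>; swapping \<open>x\<close> and \<open>y\<close> maps one part onto the other and moves the arguments
  of \<open>\<phi>\<close> towards the diagonal.\<close>

lemma antidiagonal_unimodal_split_integral:
  assumes \<phi>: "antidiagonal_unimodal \<phi>"
    and meas: "(\<lambda>p. \<phi> (fst p) (snd p)) \<in> borel_measurable (borel \<Otimes>\<^sub>M borel)"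
    and T [measurable]: "T \<in> sets borel"
  shows "antidiagonal_unimodal (split_integral T \<phi>)"
proof -
  have [measurable]: "(\<lambda>w. \<phi> (f w) (g w)) \<in> borel_measurable M"
    if [measurable]: "f \<in> borel_measurable M" "g \<in> borel_measurable M" for M :: "'z measure" and f g
    using measurable_compose[OF _ meas, of "\<lambda>w. (f w, g w)" M] by simp
  have \<phi>_swap: "\<phi> u v = \<phi> v u" for u v
    by (intro antisym antidiagonal_unimodalD[OF \<phi>]) auto
  have swap: "split_integral T \<phi> u v = split_integral T \<phi> v u" for u v
  proof -
    have "split_integral T \<phi> u v =
      (\<integral>\<^sup>+x. \<integral>\<^sup>+y. indicator {0..} y * indicator {0..} x * indicator T (y + x) * \<phi> (u - y) (v - x)
        \<partial>lborel \<partial>lborel)"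
      unfolding split_integral_def by (rule nn_integral_lborel_pair_swap) measurable
    then show ?thesis
      unfolding split_integral_def by (simp add: \<phi>_swap[of "u - _"] ac_simps)
  qed
  have main: "split_integral T \<phi> u v \<le> split_integral T \<phi> u' v'"
    if eq: "u + v = u' + v'" and le: "u' - v' \<le> u - v" and u'v': "v' \<le> u'" for u v u' v'
  proof -
    define \<delta> where "\<delta> = u - u'"
    have \<delta>: "\<delta> \<ge> 0" "u' = u - \<delta>" "v' = v + \<delta>"
      using eq le by (auto simp: \<delta>_def)
    define q where "q x y = (indicator {0..} x * indicator {0..} y * indicator T (x + y) :: ennreal)"
      for x y :: real
    have [measurable]: "(\<lambda>w. q (f w) (g w)) \<in> borel_measurable M"
      if [measurable]: "f \<in> borel_measurable M" "g \<in> borel_measurable M" for M :: "'z measure" and f g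
      unfolding q_def by measurable
    have 1: "split_integral T \<phi> u v =
      (\<integral>\<^sup>+x. \<integral>\<^sup>+y. indicator {\<delta>..} x * q x y * \<phi> (u - x) (v - y) \<partial>lborel \<partial>lborel) +
      (\<integral>\<^sup>+x. \<integral>\<^sup>+y. indicator {..<\<delta>} x * q x y * \<phi> (u - x) (v - y) \<partial>lborel \<partial>lborel)"
      unfolding split_integral_def
      by (simp add: nn_integral_add[symmetric])
         (auto intro!: nn_integral_cong simp: q_def indicator_def)
    have 2: "split_integral T \<phi> u' v' =
      (\<integral>\<^sup>+x. \<integral>\<^sup>+y. indicator {\<delta>..} y * q x y * \<phi> (u' - x) (v' - y) \<partial>lborel \<partial>lborel) +
      (\<integral>\<^sup>+x. \<integral>\<^sup>+y. indicator {..<\<delta>} y * q x y * \<phi> (u' - x) (v' - y) \<partial>lborel \<partial>lborel)"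
      unfolding split_integral_def
      by (simp add: nn_integral_add[symmetric])
         (auto intro!: nn_integral_cong simp: q_def indicator_def)
    have "(\<integral>\<^sup>+x. \<integral>\<^sup>+y. indicator {\<delta>..} x * q x y * \<phi> (u - x) (v - y) \<partial>lborel \<partial>lborel) =
      (\<integral>\<^sup>+x. \<integral>\<^sup>+y. indicator {\<delta>..} (x + \<delta>) * q (x + \<delta>) y * \<phi> (u - (x + \<delta>)) (v - y) \<partial>lborel \<partial>lborel)"
      by (rule nn_integral_lborel_shift) measurable
    also have "\<dots> = (\<integral>\<^sup>+x. \<integral>\<^sup>+y. indicator {\<delta>..} (x + \<delta>) * q (x + \<delta>) (y + - \<delta>) *
         \<phi> (u - (x + \<delta>)) (v - (y + - \<delta>)) \<partial>lborel \<partial>lborel)"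
      by (intro nn_integral_cong nn_integral_lborel_shift) measurable
    also have "\<dots> = (\<integral>\<^sup>+x. \<integral>\<^sup>+y. indicator {\<delta>..} y * q x y * \<phi> (u' - x) (v' - y) \<partial>lborel \<partial>lborel)"
      using \<delta> by (intro nn_integral_cong) (auto simp: q_def indicator_def algebra_simps)
    finally have 3: "(\<integral>\<^sup>+x. \<integral>\<^sup>+y. indicator {\<delta>..} x * q x y * \<phi> (u - x) (v - y) \<partial>lborel \<partial>lborel) =
      (\<integral>\<^sup>+x. \<integral>\<^sup>+y. indicator {\<delta>..} y * q x y * \<phi> (u' - x) (v' - y) \<partial>lborel \<partial>lborel)" .
    have "(\<integral>\<^sup>+x. \<integral>\<^sup>+y. indicator {..<\<delta>} x * q x y * \<phi> (u - x) (v - y) \<partial>lborel \<partial>lborel) \<le>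
      (\<integral>\<^sup>+x. \<integral>\<^sup>+y. indicator {..<\<delta>} x * q y x * \<phi> (u' - y) (v' - x) \<partial>lborel \<partial>lborel)"
    proof (intro nn_integral_mono)
      fix x y :: real
      \<comment> \<open>The gap on the left is \<open>(u' - v') + 2 * \<delta> - x + y\<close>, the
        one on the right \<open>(u' - v') + x - y\<close>. The former is nonnegative and dominates
        the latter in absolute value because \<open>x < \<delta>\<close>, \<open>0 \<le> y\<close>
        and \<open>v' \<le> u'\<close>.\<close>
      have "\<phi> (u - x) (v - y) \<le> \<phi> (u' - y) (v' - x)" if "x < \<delta>" "y \<ge> 0" "x \<ge> 0"
        by (rule antidiagonal_unimodalD[OF \<phi>]) (use that eq le u'v' \<delta> in \<open>auto\<close>)
      then show "indicator {..<\<delta>} x * q x y * \<phi> (u - x) (v - y) \<le>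
          indicator {..<\<delta>} x * q y x * \<phi> (u' - y) (v' - x)"
        by (auto simp: q_def indicator_def add.commute)
    qed
    also have "\<dots> = (\<integral>\<^sup>+x. \<integral>\<^sup>+y. indicator {..<\<delta>} y * q x y * \<phi> (u' - x) (v' - y) \<partial>lborel \<partial>lborel)"
      by (rule nn_integral_lborel_pair_swap) measurable
    finally show ?thesis
      unfolding 1 2 3 by (rule add_left_mono)
  qed
  show ?thesis
    unfolding antidiagonal_unimodal_def
  proof (intro allI impI)
    fix u v u' v' :: real assume eq: "u + v = u' + v'" and le: "\<bar>u' - v'\<bar> \<le> \<bar>u - v\<bar>"
    \<comment> \<open>By symmetry both pairs may be put in decreasing order, which is the case
      treated in \<open>main\<close>.\<close>
    have "split_integral T \<phi> u v = split_integral T \<phi> (max u v) (min u v)"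
      by (cases "u \<le> v") (auto simp: max_def min_def swap)
    also have "\<dots> \<le> split_integral T \<phi> (max u' v') (min u' v')"
      by (rule main) (use eq le in auto)
    also have "\<dots> = split_integral T \<phi> u' v'"
      by (cases "u' \<le> v'") (auto simp: max_def min_def swap)
    finally show "split_integral T \<phi> u v \<le> split_integral T \<phi> u' v'" .
  qed
qed

interpretation lborel_product: product_sigma_finite "\<lambda>_. lborel :: real measure"
  by standard

text \<open>The row constraint \<open>T i\<close> depends on the row because the entries of the
  remaining columns, held fixed, use up different amounts of the row sums.\<close>

definition two_column_volume ::
    "'r set \<Rightarrow> 'c \<Rightarrow> 'c \<Rightarrow> ('r \<Rightarrow> real set) \<Rightarrow> real \<Rightarrow> real \<Rightarrow> ennreal" where
  "two_column_volume R a b T u v =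
     (\<integral>\<^sup>+z. indicator {z. (\<forall>i\<in>R. 0 \<le> z (i, a) \<and> 0 \<le> z (i, b) \<and> z (i, a) + z (i, b) \<in> T i) \<and>
          (\<Sum>i\<in>R. z (i, a)) \<le> u \<and> (\<Sum>i\<in>R. z (i, b)) \<le> v} z \<partial>PiM (R \<times> {a, b}) (\<lambda>_. lborel))"

text \<open>Fubini for the two new entries \<open>x\<close> and \<open>y\<close>: their own
  constraints become the indicators in \<open>split_integral\<close>, and they lower the bounds left
  for the old rows to \<open>u - x\<close> and \<open>v - y\<close>.\<close>

lemma two_column_volume_insert:
  assumes R: "finite R" "r \<notin> R" and ab: "a \<noteq> b" and T: "\<And>i. T i \<in> sets borel"
  shows "two_column_volume (insert r R) a b T u v =
    split_integral (T r) (two_column_volume R a b T) u v"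
proof -
  define S where "S R u v = {z. (\<forall>i\<in>R. 0 \<le> z (i, a) \<and> 0 \<le> z (i, b) \<and> z (i, a) + z (i, b) \<in> T i) \<and>
          (\<Sum>i\<in>R. z (i, a)) \<le> u \<and> (\<Sum>i\<in>R. z (i, b)) \<le> (v::real)}" for R u v
  have [measurable]: "Measurable.pred M (\<lambda>x. f x \<in> T i)"
    if "f \<in> borel_measurable M" for M :: "'z measure" and f i
    using measurable_sets[OF that T] by (auto simp: pred_def vimage_def Int_def conj_commute)
  have meas: "(\<lambda>z. indicator (S A u v) z :: ennreal) \<in> borel_measurable (PiM (B \<times> {a, b}) (\<lambda>_. lborel))"
    if "finite A" "A \<subseteq> B" for u v A B
  proof -
    have [measurable]: "(\<lambda>z. z (i, a)) \<in> borel_measurable (PiM (B \<times> {a, b}) (\<lambda>_. lborel :: real measure))"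
        "(\<lambda>z. z (i, b)) \<in> borel_measurable (PiM (B \<times> {a, b}) (\<lambda>_. lborel :: real measure))"
      if "i \<in> A" for i
      using measurable_component_singleton[of "(i, a)" "B \<times> {a, b}" "\<lambda>_. lborel :: real measure"]
            measurable_component_singleton[of "(i, b)" "B \<times> {a, b}" "\<lambda>_. lborel :: real measure"]
        that \<open>A \<subseteq> B\<close> by auto
    have "Measurable.pred (PiM (B \<times> {a, b}) (\<lambda>_. lborel)) (\<lambda>z. z \<in> S A u v)"
      unfolding S_def mem_Collect_eq using \<open>finite A\<close> by measurable
    then show ?thesis by (subst borel_measurable_indicator_iff) (auto simp: pred_def Int_def conj_commute)
  qed
  have eq: "insert r R \<times> {a, b} = insert (r, a) (insert (r, b) (R \<times> {a, b}))"
    by auto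
  have upd: "indicator (S (insert r R) u v) (z((r, b) := y, (r, a) := x)) =
     (indicator {0..} x * indicator {0..} y * indicator (T r) (x + y) * indicator (S R (u - x) (v - y)) z :: ennreal)"
    for x y z
  proof -
    have "(\<Sum>i\<in>R. (z((r, b) := y, (r, a) := x)) (i, a)) = (\<Sum>i\<in>R. z (i, a))"
         "(\<Sum>i\<in>R. (z((r, b) := y, (r, a) := x)) (i, b)) = (\<Sum>i\<in>R. z (i, b))"
      using R by (auto intro!: sum.cong)
    then have "z((r, b) := y, (r, a) := x) \<in> S (insert r R) u v \<longleftrightarrow>
      0 \<le> x \<and> 0 \<le> y \<and> x + y \<in> T r \<and> z \<in> S R (u - x) (v - y)"
      using R ab unfolding S_def by (auto simp: algebra_simps)
    then show ?thesis by (auto simp: indicator_def)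
  qed
  have m: "(\<lambda>z. indicator (S (insert r R) u v) z :: ennreal) \<in>
      borel_measurable (PiM (insert (r, a) (insert (r, b) (R \<times> {a, b}))) (\<lambda>_. lborel))"
    using meas[of "insert r R" "insert r R" u v] R unfolding eq by simp
  have "two_column_volume (insert r R) a b T u v =
     (\<integral>\<^sup>+z. indicator (S (insert r R) u v) z
        \<partial>PiM (insert (r, a) (insert (r, b) (R \<times> {a, b}))) (\<lambda>_. lborel))"
    unfolding two_column_volume_def eq S_def ..
  also have "\<dots> = (\<integral>\<^sup>+x. \<integral>\<^sup>+w. indicator (S (insert r R) u v) (w((r, a) := x))
        \<partial>PiM (insert (r, b) (R \<times> {a, b})) (\<lambda>_. lborel) \<partial>lborel)"
    using R ab m by (intro lborel_product.product_nn_integral_insert_rev) auto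
  also have "\<dots> = (\<integral>\<^sup>+x. \<integral>\<^sup>+y. \<integral>\<^sup>+z. indicator (S (insert r R) u v) (z((r, b) := y, (r, a) := x))
        \<partial>PiM (R \<times> {a, b}) (\<lambda>_. lborel) \<partial>lborel \<partial>lborel)"
  proof (intro nn_integral_cong lborel_product.product_nn_integral_insert_rev)
    fix x :: real
    have "(\<lambda>w. w((r, a) := x)) \<in> measurable (PiM (insert (r, b) (R \<times> {a, b})) (\<lambda>_. lborel))
       (PiM (insert (r, a) (insert (r, b) (R \<times> {a, b}))) (\<lambda>_. lborel))"
      by (rule measurable_fun_upd[where J = "insert (r, b) (R \<times> {a, b})"]) auto
    from measurable_compose[OF this m]
    show "(\<lambda>w. indicator (S (insert r R) u v) (w((r, a) := x)) :: ennreal) \<in>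
        borel_measurable (PiM (insert (r, b) (R \<times> {a, b})) (\<lambda>_. lborel))" .
  qed (use R in auto)
  also have "\<dots> = split_integral (T r) (two_column_volume R a b T) u v"
    unfolding upd split_integral_def two_column_volume_def S_def[symmetric]
    by (intro nn_integral_cong nn_integral_cmult meas R order_refl)
  finally show ?thesis .
qed

text \<open>Induction over the rows. Without rows the volume is the indicator of the closed first
  quadrant, which along with a point contains every point of the same antidiagonal nearer to the
  diagonal. Measurability is carried along because the step for \<open>split_integral\<close>
  requires it.\<close>

lemma two_column_volume_unimodal:
  assumes R: "finite R" and ab: "a \<noteq> b" and T: "\<And>i. T i \<in> sets borel"
  shows "antidiagonal_unimodal (two_column_volume R a b T) \<and>
    (\<lambda>p. two_column_volume R a b T (fst p) (snd p)) \<in> borel_measurable (borel \<Otimes>\<^sub>M borel)"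
  using R
proof (induction R rule: finite_induct)
  case empty
  have eq: "two_column_volume {} a b T = (\<lambda>u v. indicator {0..} u * indicator {0..} v)"
    unfolding two_column_volume_def
    by (auto simp: fun_eq_iff PiM_empty nn_integral_count_space_finite indicator_def)
  show ?case
    unfolding eq antidiagonal_unimodal_def by (auto simp: indicator_def)
next
  case (insert r R)
  have eq: "two_column_volume (insert r R) a b T = split_integral (T r) (two_column_volume R a b T)"
    using two_column_volume_insert[OF insert.hyps ab T] by (simp add: fun_eq_iff)
  show ?case
    unfolding eq
    by (intro conjI antidiagonal_unimodal_split_integral measurable_split_integral)
      (use insert.IH T in auto)
qed

section \<open>Comparison with equal column bounds\<close>

definition column_bounded_matrices ::
    "'r set \<Rightarrow> 'c set \<Rightarrow> real set \<Rightarrow> ('c \<Rightarrow> real) \<Rightarrow> ('r \<times> 'c \<Rightarrow> real) set" where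
  "column_bounded_matrices R C T c =
     {A \<in> space (PiM (R \<times> C) (\<lambda>_. lborel)).
        (\<forall>i\<in>R. \<forall>j\<in>C. 0 \<le> A (i, j)) \<and>
        (\<forall>i\<in>R. (\<Sum>j\<in>C. A (i, j)) \<in> T) \<and>
        (\<forall>j\<in>C. (\<Sum>i\<in>R. A (i, j)) \<le> c j)}"

lemma sets_column_bounded_matrices [measurable]:
  assumes [simp]: "finite R" "finite C" and [measurable]: "T \<in> sets borel"
  shows "column_bounded_matrices R C T c \<in> sets (PiM (R \<times> C) (\<lambda>_. lborel))"
proof -
  have [measurable]: "(\<lambda>A. A (i, j)) \<in> borel_measurable (PiM (R \<times> C) (\<lambda>_. lborel :: real measure))"
    if "i \<in> R" "j \<in> C" for i j
    using measurable_component_singleton[of "(i, j)" "R \<times> C" "\<lambda>_. lborel :: real measure"] that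
    by simp
  show ?thesis
    unfolding column_bounded_matrices_def by measurable
qed

text \<open>Fubini with columns \<open>a\<close> and \<open>b\<close> in the inner integral. The
  other columns only decide whether the integrand vanishes and by how much \<open>T\<close> is
  shifted in each row.\<close>

lemma emeasure_column_bounded_matrices:
  assumes fin: "finite R" "finite C" and T: "T \<in> sets borel" and ab: "a \<in> C" "b \<in> C" "a \<noteq> b"
  shows "emeasure (PiM (R \<times> C) (\<lambda>_. lborel)) (column_bounded_matrices R C T c) =
    (\<integral>\<^sup>+x. (if (\<forall>i\<in>R. \<forall>j\<in>C - {a, b}. 0 \<le> x (i, j)) \<and> (\<forall>j\<in>C - {a, b}. (\<Sum>i\<in>R. x (i, j)) \<le> c j)
       then two_column_volume R a b (\<lambda>i. {t. t + (\<Sum>j\<in>C - {a, b}. x (i, j)) \<in> T}) (c a) (c b) else 0)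
     \<partial>PiM (R \<times> (C - {a, b})) (\<lambda>_. lborel))"
proof -
  let ?W = "column_bounded_matrices R C T c"
  define I where "I = R \<times> (C - {a, b})"
  define J where "J = R \<times> {a, b}"
  have IJ: "R \<times> C = I \<union> J" "I \<inter> J = {}" "finite I" "finite J"
    using ab fin by (auto simp: I_def J_def)
  have W: "?W \<in> sets (PiM (I \<union> J) (\<lambda>_. lborel))"
    using sets_column_bounded_matrices[OF fin T] IJ(1) by simp
  have "emeasure (PiM (R \<times> C) (\<lambda>_. lborel)) ?W = (\<integral>\<^sup>+A. indicator ?W A \<partial>PiM (I \<union> J) (\<lambda>_. lborel))"
    using W by (simp add: IJ(1))
  also have "\<dots> = (\<integral>\<^sup>+x. \<integral>\<^sup>+y. indicator ?W (merge I J (x, y)) \<partial>PiM J (\<lambda>_. lborel) \<partial>PiM I (\<lambda>_. lborel))"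
    using W by (intro lborel_product.product_nn_integral_fold IJ) auto
  also have "\<dots> = (\<integral>\<^sup>+x. (if (\<forall>i\<in>R. \<forall>j\<in>C - {a, b}. 0 \<le> x (i, j)) \<and>
          (\<forall>j\<in>C - {a, b}. (\<Sum>i\<in>R. x (i, j)) \<le> c j)
       then two_column_volume R a b (\<lambda>i. {t. t + (\<Sum>j\<in>C - {a, b}. x (i, j)) \<in> T}) (c a) (c b) else 0)
     \<partial>PiM I (\<lambda>_. lborel))"
  proof (rule nn_integral_cong)
    fix x :: "'a \<times> 'b \<Rightarrow> real" assume x: "x \<in> space (PiM I (\<lambda>_. lborel))"
    let ?O = "(\<forall>i\<in>R. \<forall>j\<in>C - {a, b}. 0 \<le> x (i, j)) \<and> (\<forall>j\<in>C - {a, b}. (\<Sum>i\<in>R. x (i, j)) \<le> c j)"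
    let ?S = "{z. (\<forall>i\<in>R. 0 \<le> z (i, a) \<and> 0 \<le> z (i, b) \<and>
           z (i, a) + z (i, b) \<in> {t. t + (\<Sum>j\<in>C - {a, b}. x (i, j)) \<in> T}) \<and>
          (\<Sum>i\<in>R. z (i, a)) \<le> c a \<and> (\<Sum>i\<in>R. z (i, b)) \<le> c b}"
    have mem: "merge I J (x, y) \<in> ?W \<longleftrightarrow> ?O \<and> y \<in> ?S" if y: "y \<in> space (PiM J (\<lambda>_. lborel))" for y
    proof -
      have m1: "merge I J (x, y) (i, j) = x (i, j)" if "i \<in> R" "j \<in> C - {a, b}" for i j
        using that by (auto simp: merge_def I_def)
      have m2: "merge I J (x, y) (i, j) = y (i, j)" if "i \<in> R" "j \<in> {a, b}" for i j
        using that by (auto simp: merge_def I_def J_def)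
      have sp: "merge I J (x, y) \<in> space (PiM (R \<times> C) (\<lambda>_. lborel))"
        unfolding IJ(1) by (simp add: space_PiM PiE_def)
      have C: "C = insert a (insert b (C - {a, b}))"
        using ab by auto
      have row: "(\<Sum>j\<in>C. merge I J (x, y) (i, j)) = y (i, a) + y (i, b) + (\<Sum>j\<in>C - {a, b}. x (i, j))"
        if "i \<in> R" for i
        using fin ab that by (subst C) (simp add: m1 m2 add.assoc)
      have col: "(\<Sum>i\<in>R. merge I J (x, y) (i, j)) = (\<Sum>i\<in>R. x (i, j))" if "j \<in> C - {a, b}" for j
        using that m1 by (intro sum.cong) auto
      have cola: "(\<Sum>i\<in>R. merge I J (x, y) (i, a)) = (\<Sum>i\<in>R. y (i, a))"
        and colb: "(\<Sum>i\<in>R. merge I J (x, y) (i, b)) = (\<Sum>i\<in>R. y (i, b))"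
        using m2 by (auto intro!: sum.cong)
      have all: "(\<forall>j\<in>C. P j) \<longleftrightarrow> P a \<and> P b \<and> (\<forall>j\<in>C - {a, b}. P j)" for P
        using ab by auto
      show ?thesis
        unfolding column_bounded_matrices_def mem_Collect_eq all
        using sp m1 m2 row col cola colb by auto
    qed
    have "(\<integral>\<^sup>+y. indicator ?W (merge I J (x, y)) \<partial>PiM J (\<lambda>_. lborel)) =
       (\<integral>\<^sup>+y. (if ?O then indicator ?S y else 0) \<partial>PiM J (\<lambda>_. lborel))"
      by (intro nn_integral_cong) (simp add: mem indicator_def)
    then show "(\<integral>\<^sup>+y. indicator ?W (merge I J (x, y)) \<partial>PiM J (\<lambda>_. lborel)) =
       (if ?O then two_column_volume R a b (\<lambda>i. {t. t + (\<Sum>j\<in>C - {a, b}. x (i, j)) \<in> T}) (c a) (c b) else 0)"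
      unfolding two_column_volume_def J_def[symmetric] by (cases ?O) auto
  qed
  finally show ?thesis unfolding I_def .
qed

text \<open>The integrands are compared pointwise: the condition on the other columns is the same
  for \<open>c\<close> and \<open>c'\<close>, and the two-column volume does not decrease by
  unimodality.\<close>

lemma emeasure_column_bounded_matrices_balance:
  assumes fin: "finite R" "finite C" and T: "T \<in> sets borel" and ab: "a \<in> C" "b \<in> C" "a \<noteq> b"
    and c': "\<And>j. j \<in> C - {a, b} \<Longrightarrow> c' j = c j" "c' a + c' b = c a + c b" "\<bar>c' a - c' b\<bar> \<le> \<bar>c a - c b\<bar>"
  shows "emeasure (PiM (R \<times> C) (\<lambda>_. lborel)) (column_bounded_matrices R C T c) \<le>
    emeasure (PiM (R \<times> C) (\<lambda>_. lborel)) (column_bounded_matrices R C T c')"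
  unfolding emeasure_column_bounded_matrices[OF fin T ab]
proof (rule nn_integral_mono)
  fix x :: "'a \<times> 'b \<Rightarrow> real"
  have "{t. t + s \<in> T} \<in> sets borel" for s :: real
    using measurable_sets[of "\<lambda>t. t + s" borel borel T] T by (simp add: vimage_def)
  then have 1: "two_column_volume R a b (\<lambda>i. {t. t + (\<Sum>j\<in>C - {a, b}. x (i, j)) \<in> T}) (c a) (c b) \<le>
      two_column_volume R a b (\<lambda>i. {t. t + (\<Sum>j\<in>C - {a, b}. x (i, j)) \<in> T}) (c' a) (c' b)"
    using c'(2,3) two_column_volume_unimodal[OF fin(1) ab(3)]
    by (intro antidiagonal_unimodalD) auto
  have 2: "(\<forall>j\<in>C - {a, b}. (\<Sum>i\<in>R. x (i, j)) \<le> c' j) =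
      (\<forall>j\<in>C - {a, b}. (\<Sum>i\<in>R. x (i, j)) \<le> c j)"
    by (intro ball_cong refl) (simp add: c'(1))
  have mono: "(if P \<and> Q then x else 0) \<le> (if P \<and> Q' then y else 0)"
    if "x \<le> y" "Q' = Q" for P Q Q' and x y :: ennreal
    using that by simp
  show "(if (\<forall>i\<in>R. \<forall>j\<in>C - {a, b}. 0 \<le> x (i, j)) \<and> (\<forall>j\<in>C - {a, b}. (\<Sum>i\<in>R. x (i, j)) \<le> c j)
       then two_column_volume R a b (\<lambda>i. {t. t + (\<Sum>j\<in>C - {a, b}. x (i, j)) \<in> T}) (c a) (c b) else 0)
    \<le> (if (\<forall>i\<in>R. \<forall>j\<in>C - {a, b}. 0 \<le> x (i, j)) \<and> (\<forall>j\<in>C - {a, b}. (\<Sum>i\<in>R. x (i, j)) \<le> c' j)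
       then two_column_volume R a b (\<lambda>i. {t. t + (\<Sum>j\<in>C - {a, b}. x (i, j)) \<in> T}) (c' a) (c' b) else 0)"
    by (rule mono[OF 1 2])
qed

text \<open>Induction on the total excess over \<open>n\<close>, where truncated subtraction counts
  only the columns above \<open>n\<close>. Without excess monotonicity suffices; otherwise the bound
  on the total leaves a column below \<open>n\<close> to which one unit can be moved.\<close>

lemma emeasure_column_bounded_matrices_le_uniform:
  fixes c :: "'c \<Rightarrow> nat" and s :: real
  assumes fin: "finite R" "finite C" and T: "T \<in> sets borel" and s: "s \<ge> 0"
    and c: "(\<Sum>j\<in>C. c j) \<le> card C * n"
  shows "emeasure (PiM (R \<times> C) (\<lambda>_. lborel)) (column_bounded_matrices R C T (\<lambda>j. real (c j) * s)) \<le>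
    emeasure (PiM (R \<times> C) (\<lambda>_. lborel)) (column_bounded_matrices R C T (\<lambda>j. real n * s))"
  using c
proof (induction "\<Sum>j\<in>C. c j - n" arbitrary: c rule: less_induct)
  case less
  show ?case
  proof (cases "\<forall>j\<in>C. c j \<le> n")
    case True
    then have "real (c j) * s \<le> real n * s" if "j \<in> C" for j
      using s that by (intro mult_right_mono) auto
    then have "column_bounded_matrices R C T (\<lambda>j. real (c j) * s) \<subseteq>
        column_bounded_matrices R C T (\<lambda>j. real n * s)"
      unfolding column_bounded_matrices_def
      by (blast intro: order_trans)
    then show ?thesis
      by (rule emeasure_mono) (use fin T in measurable)
  next
    case False
    then obtain a where a: "a \<in> C" "c a > n" by auto
    have "\<exists>b\<in>C. c b < n"
    proof (rule ccontr)
      assume "\<not> ?thesis"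
      then have "(\<Sum>j\<in>C. n) < (\<Sum>j\<in>C. c j)"
        using a fin by (intro sum_strict_mono_ex1) (auto simp: not_less)
      then show False using less.prems by simp
    qed
    then obtain b where b: "b \<in> C" "c b < n" by auto
    define c' where "c' = c(a := c a - 1, b := c b + 1)"
    have ab: "a \<noteq> b" using a b by auto
    have C: "C = insert a (insert b (C - {a, b}))" using a b by auto
    have split: "(\<Sum>j\<in>C. f j) = f a + (f b + (\<Sum>j\<in>C - {a, b}. f j))" for f :: "'c \<Rightarrow> nat"
      using fin ab by (subst C) simp
    have rest: "(\<Sum>j\<in>C - {a, b}. f (c' j)) = (\<Sum>j\<in>C - {a, b}. f (c j))" for f :: "nat \<Rightarrow> nat"
      by (intro sum.cong) (auto simp: c'_def)
    \<comment> \<open>The excess at \<open>a\<close> falls by one; at \<open>b\<close> it stays zero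
      because \<open>c b + 1 \<le> n\<close>.\<close>
    have "(\<Sum>j\<in>C. c' j - n) < (\<Sum>j\<in>C. c j - n)"
      using a b ab unfolding split rest[of "\<lambda>x. x - n"] by (simp add: c'_def)
    moreover have "(\<Sum>j\<in>C. c' j) \<le> card C * n"
      using less.prems a b ab unfolding split rest[of "\<lambda>x. x"] by (simp add: c'_def)
    ultimately have "emeasure (PiM (R \<times> C) (\<lambda>_. lborel)) (column_bounded_matrices R C T (\<lambda>j. real (c' j) * s)) \<le>
      emeasure (PiM (R \<times> C) (\<lambda>_. lborel)) (column_bounded_matrices R C T (\<lambda>j. real n * s))"
      by (rule less.hyps)
    moreover have "emeasure (PiM (R \<times> C) (\<lambda>_. lborel)) (column_bounded_matrices R C T (\<lambda>j. real (c j) * s)) \<le>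
      emeasure (PiM (R \<times> C) (\<lambda>_. lborel)) (column_bounded_matrices R C T (\<lambda>j. real (c' j) * s))"
    proof (rule emeasure_column_bounded_matrices_balance[OF fin T a(1) b(1) ab])
      show "real (c' a) * s + real (c' b) * s = real (c a) * s + real (c b) * s"
        using a ab by (simp add: c'_def of_nat_diff algebra_simps)
      have "\<bar>real (c' a) * s - real (c' b) * s\<bar> = \<bar>real (c' a) - real (c' b)\<bar> * s"
        using s by (simp add: abs_mult flip: left_diff_distrib)
      \<comment> \<open>Since \<open>c b < n < c a\<close>, the gap is at least 2 and shrinks by
        exactly 2.\<close>
      also have "\<dots> \<le> \<bar>real (c a) - real (c b)\<bar> * s"
        using a b ab s by (intro mult_right_mono) (auto simp: c'_def of_nat_diff)
      also have "\<dots> = \<bar>real (c a) * s - real (c b) * s\<bar>"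
        using s by (simp add: abs_mult flip: left_diff_distrib)
      finally show "\<bar>real (c' a) * s - real (c' b) * s\<bar> \<le> \<bar>real (c a) * s - real (c b) * s\<bar>" .
    qed (auto simp: c'_def)
    ultimately show ?thesis by (rule order_trans[rotated])
  qed
qed

subsection \<open>The volume of the Birkhoff polytope\<close>

definition row_bounded_matrices ::
    "'r set \<Rightarrow> 'c set \<Rightarrow> real set \<Rightarrow> ('r \<times> 'c \<Rightarrow> real) set" where
  "row_bounded_matrices R C T =
     {A \<in> space (PiM (R \<times> C) (\<lambda>_. lborel)).
        \<forall>i\<in>R. (\<forall>j\<in>C. 0 \<le> A (i, j)) \<and> (\<Sum>j\<in>C. A (i, j)) \<in> T}"

lemma sets_row_bounded_matrices [measurable]:
  assumes [simp]: "finite R" "finite C" and [measurable]: "T \<in> sets borel"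
  shows "row_bounded_matrices R C T \<in> sets (PiM (R \<times> C) (\<lambda>_. lborel))"
proof -
  have [measurable]: "(\<lambda>A. A (i, j)) \<in> borel_measurable (PiM (R \<times> C) (\<lambda>_. lborel :: real measure))"
    if "i \<in> R" "j \<in> C" for i j
    using measurable_component_singleton[of "(i, j)" "R \<times> C" "\<lambda>_. lborel :: real measure"] that
    by simp
  show ?thesis
    unfolding row_bounded_matrices_def by measurable
qed

text \<open>The half-open interval makes the set a difference of two closed standard simplices,
  scaled by \<open>t\<close> and by \<open>s\<close>.\<close>

lemma emeasure_single_row:
  fixes r :: 'r and C :: "'c set"
  assumes "finite C" "C \<noteq> {}" "0 \<le> s" "s \<le> t"
  shows "emeasure (PiM ({r} \<times> C) (\<lambda>_. lborel)) (row_bounded_matrices {r} C {s<..t}) =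
    ennreal ((t ^ card C - s ^ card C) / fact (card C))"
proof -
  let ?M = "PiM ({r} \<times> C) (\<lambda>_. lborel :: real measure)"
  define S where "S t = {x. (\<forall>p\<in>{r} \<times> C. 0 \<le> x p) \<and> sum x ({r} \<times> C) \<le> t} \<inter> space ?M" for t :: real
  have sum: "sum x ({r} \<times> C) = (\<Sum>j\<in>C. x (r, j))" for x :: "'r \<times> 'c \<Rightarrow> real"
    by (simp add: sum.cartesian_product' )
  have S: "emeasure ?M (S t) = ennreal (t ^ card C / fact (card C))" if "t \<ge> 0" for t
    unfolding S_def using emeasure_std_simplex_aux[of "{r} \<times> C" t] that assms
    by (simp add: card_cartesian_product)
  have meas: "S t \<in> sets ?M" for t
  proof -
    have [measurable]: "(\<lambda>A. A p) \<in> borel_measurable ?M" if "p \<in> {r} \<times> C" for p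
      using measurable_component_singleton[OF that, of "\<lambda>_. lborel :: real measure"] by simp
    have [simp]: "finite ({r} \<times> C)"
      using \<open>finite C\<close> by simp
    have "S t = {A \<in> space ?M. (\<forall>p\<in>{r} \<times> C. 0 \<le> A p) \<and> sum A ({r} \<times> C) \<le> t}"
      by (auto simp: S_def)
    also have "\<dots> \<in> sets ?M"
      by measurable
    finally show ?thesis .
  qed
  have "row_bounded_matrices {r} C {s<..t} = S t - S s"
    unfolding row_bounded_matrices_def S_def sum by auto
  also have "emeasure ?M \<dots> = emeasure ?M (S t) - emeasure ?M (S s)"
    using assms S[of s] by (intro emeasure_Diff meas) (auto simp: S_def)
  also have "\<dots> = ennreal (t ^ card C / fact (card C) - s ^ card C / fact (card C))"
    using assms S[of s] S[of t] by (simp add: ennreal_minus)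
  finally show ?thesis by (simp add: diff_divide_distrib)
qed

text \<open>The constraint on each row involves that row alone, so by Fubini the rows contribute
  equal factors; the empty product space is a unit point mass.\<close>

lemma emeasure_row_bounded_matrices:
  assumes "finite R" "finite C" "C \<noteq> {}" "0 \<le> s" "s \<le> t"
  shows "emeasure (PiM (R \<times> C) (\<lambda>_. lborel)) (row_bounded_matrices R C {s<..t}) =
    ennreal ((t ^ card C - s ^ card C) / fact (card C)) ^ card R"
  using assms(1)
proof (induction R rule: finite_induct)
  case empty
  show ?case
    by (simp add: row_bounded_matrices_def PiM_empty one_ennreal_def)
next
  case (insert r R)
  let ?T = "{s<..t}"
  define I where "I = {r} \<times> C"
  define J where "J = R \<times> C"
  have IJ: "insert r R \<times> C = I \<union> J" "I \<inter> J = {}" "finite I" "finite J"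
    using insert.hyps assms by (auto simp: I_def J_def)
  let ?W = "row_bounded_matrices (insert r R) C ?T"
  have W: "?W \<in> sets (PiM (I \<union> J) (\<lambda>_. lborel))"
    using sets_row_bounded_matrices[of "insert r R" C ?T] IJ(1) insert.hyps assms by simp
  have "emeasure (PiM (insert r R \<times> C) (\<lambda>_. lborel)) ?W =
      (\<integral>\<^sup>+A. indicator ?W A \<partial>PiM (I \<union> J) (\<lambda>_. lborel))"
    using W by (simp add: IJ(1))
  also have "\<dots> = (\<integral>\<^sup>+x. \<integral>\<^sup>+y. indicator ?W (merge I J (x, y)) \<partial>PiM J (\<lambda>_. lborel) \<partial>PiM I (\<lambda>_. lborel))"
    using W by (intro lborel_product.product_nn_integral_fold IJ) auto
  also have "\<dots> = (\<integral>\<^sup>+x. \<integral>\<^sup>+y. indicator (row_bounded_matrices {r} C ?T) x *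
       indicator (row_bounded_matrices R C ?T) y \<partial>PiM J (\<lambda>_. lborel) \<partial>PiM I (\<lambda>_. lborel))"
  proof (intro nn_integral_cong)
    fix x y :: "'a \<times> 'b \<Rightarrow> real"
    assume xy: "x \<in> space (PiM I (\<lambda>_. lborel))" "y \<in> space (PiM J (\<lambda>_. lborel))"
    have m1: "merge I J (x, y) (r, j) = x (r, j)" if "j \<in> C" for j
      using that by (auto simp: merge_def I_def)
    have m2: "merge I J (x, y) (i, j) = y (i, j)" if "i \<in> R" "j \<in> C" for i j
      using that insert.hyps by (auto simp: merge_def I_def J_def)
    have sp: "merge I J (x, y) \<in> space (PiM (insert r R \<times> C) (\<lambda>_. lborel))"
      unfolding IJ(1) by (simp add: space_PiM PiE_def)
    have "merge I J (x, y) \<in> ?W \<longleftrightarrow> x \<in> row_bounded_matrices {r} C ?T \<and> y \<in> row_bounded_matrices R C ?T"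
      using sp xy m1 m2 unfolding row_bounded_matrices_def I_def J_def by simp
    then show "indicator ?W (merge I J (x, y)) = (indicator (row_bounded_matrices {r} C ?T) x *
       indicator (row_bounded_matrices R C ?T) y :: ennreal)"
      by (simp add: indicator_def)
  qed
  also have "\<dots> = emeasure (PiM I (\<lambda>_. lborel)) (row_bounded_matrices {r} C ?T) *
      emeasure (PiM J (\<lambda>_. lborel)) (row_bounded_matrices R C ?T)"
    using insert.hyps assms unfolding I_def J_def
    by (simp add: nn_integral_cmult nn_integral_multc sets_row_bounded_matrices)
  also have "\<dots> = ennreal ((t ^ card C - s ^ card C) / fact (card C)) ^ card (insert r R)"
    using emeasure_single_row[of C s t r] assms insert unfolding I_def J_def by simp
  finally show ?case .
qed

text \<open>Pigeonhole over the column sums rounded up to multiples of \<open>s\<close>.\<close>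

lemma emeasure_row_bounded_le_column_bounded:
  fixes \<tau> s :: real
  assumes fin: "finite R" "finite C" and T: "T \<in> sets borel" "T \<subseteq> {..\<tau>}" and s: "s > 0"
    and K: "real (card R) * \<tau> \<le> real K * s" "K + card C \<le> card C * n"
  shows "emeasure (PiM (R \<times> C) (\<lambda>_. lborel)) (row_bounded_matrices R C T) \<le>
    of_nat ((K + 1) ^ card C) *
    emeasure (PiM (R \<times> C) (\<lambda>_. lborel)) (column_bounded_matrices R C T (\<lambda>j. real n * s))"
proof -
  let ?M = "PiM (R \<times> C) (\<lambda>_. lborel :: real measure)"
  let ?W = "\<lambda>c. column_bounded_matrices R C T (\<lambda>j. real (c j) * s)"
  \<comment> \<open>The vectors that rounding can produce. The bound \<open>K\<close> on the entries
    makes them countable by \<open>card_PiE\<close>; the bound on the total is what the comparison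
    with the constant vector \<open>n\<close> requires.\<close>
  define F where "F = {c \<in> PiE C (\<lambda>_. {..K}). (\<Sum>j\<in>C. c j) \<le> card C * n}"
  have fin_F: "finite F" and card_F: "card F \<le> (K + 1) ^ card C"
  proof -
    have "finite (PiE C (\<lambda>_. {..K}))"
      using fin by (intro finite_PiE) auto
    then show "finite F"
      unfolding F_def by auto
    show "card F \<le> (K + 1) ^ card C"
      using card_mono[OF \<open>finite (PiE C (\<lambda>_. {..K}))\<close>, of F] fin
      by (auto simp: F_def card_PiE)
  qed
  have cover: "row_bounded_matrices R C T \<subseteq> (\<Union>c\<in>F. ?W c)"
  proof
    fix A assume A: "A \<in> row_bounded_matrices R C T"
    have nonneg: "0 \<le> A (i, j)" if "i \<in> R" "j \<in> C" for i j
      using A that by (auto simp: row_bounded_matrices_def)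
    define col where "col j = (\<Sum>i\<in>R. A (i, j))" for j
    have col_nonneg: "0 \<le> col j" if "j \<in> C" for j
      unfolding col_def using nonneg that by (intro sum_nonneg) auto
    have "(\<Sum>j\<in>C. col j) = (\<Sum>i\<in>R. \<Sum>j\<in>C. A (i, j))"
      unfolding col_def by (rule sum.swap)
    also have "\<dots> \<le> (\<Sum>i\<in>R. \<tau>)"
      using A T by (intro sum_mono) (auto simp: row_bounded_matrices_def)
    finally have total: "(\<Sum>j\<in>C. col j) \<le> real K * s"
      using K by simp
    \<comment> \<open>Rounding up keeps \<open>A\<close> within its column bounds and adds at most
      one unit per column, which the summand \<open>card C\<close> in the second hypothesis on
      \<open>K\<close> pays for. The restriction to \<open>C\<close> makes \<open>c\<close> an
      element of the function space in \<open>F\<close>.\<close>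
    define c where "c = (\<lambda>j\<in>C. nat \<lceil>col j / s\<rceil>)"
    have c: "real (c j) \<ge> col j / s" "real (c j) \<le> col j / s + 1" if "j \<in> C" for j
      using that col_nonneg[OF that] s unfolding c_def by (auto simp: of_nat_nat)
    have "c j \<le> K" if "j \<in> C" for j
    proof -
      have "col j \<le> (\<Sum>j\<in>C. col j)"
        using that fin col_nonneg by (intro member_le_sum) auto
      then have "col j / s \<le> real K"
        using total s by (simp add: field_simps)
      then show ?thesis
        using that unfolding c_def by (simp add: ceiling_le_iff nat_le_iff)
    qed
    moreover have "(\<Sum>j\<in>C. c j) \<le> card C * n"
    proof -
      have "real (\<Sum>j\<in>C. c j) \<le> (\<Sum>j\<in>C. col j / s + 1)"
        unfolding of_nat_sum using c by (intro sum_mono) auto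
      also have "\<dots> = (\<Sum>j\<in>C. col j) / s + card C"
        by (simp add: sum.distrib sum_divide_distrib)
      also have "\<dots> \<le> real (K + card C)"
        using total s by (simp add: field_simps)
      finally have "(\<Sum>j\<in>C. c j) \<le> K + card C"
        by linarith
      then show ?thesis using K by linarith
    qed
    ultimately have "c \<in> F"
      unfolding F_def by (auto simp: c_def)
    moreover have "A \<in> ?W c"
      using A c(1) s unfolding column_bounded_matrices_def row_bounded_matrices_def col_def
      by (auto simp: field_simps)
    ultimately show "A \<in> (\<Union>c\<in>F. ?W c)" by blast
  qed
  have meas: "?W c \<in> sets ?M" for c
    using fin T by measurable
  have "emeasure ?M (row_bounded_matrices R C T) \<le> emeasure ?M (\<Union>c\<in>F. ?W c)"
    using fin_F meas by (intro emeasure_mono cover sets.finite_UN) auto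
  also have "\<dots> \<le> (\<Sum>c\<in>F. emeasure ?M (?W c))"
    using fin_F meas by (intro emeasure_subadditive_finite) auto
  also have "\<dots> \<le> (\<Sum>c\<in>F. emeasure ?M (?W (\<lambda>_. n)))"
    using fin T s by (intro sum_mono emeasure_column_bounded_matrices_le_uniform) (auto simp: F_def)
  also have "\<dots> = of_nat (card F) * emeasure ?M (?W (\<lambda>_. n))"
    by simp
  also have "\<dots> \<le> of_nat ((K + 1) ^ card C) * emeasure ?M (?W (\<lambda>_. n))"
    using card_F by (intro mult_right_mono) (auto simp del: of_nat_power of_nat_Suc)
  finally show ?thesis .
qed

section \<open>Estimates for the volume of one row\<close>

text \<open>Stirling up to a polynomial factor: the right side is
  \<open>exp 1 * m * (m / exp 1) ^ m\<close>. The induction step amounts to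
  \<open>exp 1 \<le> (1 + 1 / m) ^ (m + 1)\<close>, obtained from \<open>ln x \<le> x - 1\<close> at
  \<open>x = m / (m + 1)\<close>.\<close>

lemma fact_le_exp:
  assumes "m \<ge> 1"
  shows "fact m \<le> real m ^ (m + 1) * exp (1 - real m)"
  using assms
proof (induction m rule: dec_induct)
  case (step m)
  have "1 / (real m + 1) \<le> ln (1 + 1 / real m)"
  proof -
    have "ln (real m / (real m + 1)) \<le> real m / (real m + 1) - 1"
      using step by (intro ln_le_minus_one) auto
    also have "\<dots> = - (1 / (real m + 1))"
      by (simp add: field_simps)
    finally show ?thesis
      using step by (simp add: ln_div field_simps)
  qed
  then have "exp 1 \<le> exp ((real m + 1) * ln (1 + 1 / real m))"
    by (simp add: field_simps)
  also have "\<dots> = (1 + 1 / real m) ^ (m + 1)"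
    using exp_of_nat_mult[of "m + 1" "ln (1 + 1 / real m)"] by (simp add: add_pos_nonneg add.commute)
  finally have "exp 1 * real m ^ (m + 1) \<le> ((1 + 1 / real m) * real m) ^ (m + 1)"
    unfolding power_mult_distrib by (intro mult_right_mono) auto
  also have "(1 + 1 / real m) * real m = real m + 1"
    using step by (simp add: field_simps)
  finally have *: "exp 1 * real m ^ (m + 1) \<le> (real m + 1) ^ (m + 1)" .
  have "fact (Suc m) = (real m + 1) * fact m"
    by (simp add: add.commute)
  also have "\<dots> \<le> (real m + 1) * (real m ^ (m + 1) * exp (1 - real m))"
    by (intro mult_left_mono step.IH) auto
  also have "\<dots> = (real m + 1) * exp (- real m) * (exp 1 * real m ^ (m + 1))"
    by (simp add: exp_diff exp_minus field_simps)
  also have "\<dots> \<le> (real m + 1) * exp (- real m) * (real m + 1) ^ (m + 1)"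
    using * by (intro mult_left_mono) auto
  also have "\<dots> = real (Suc m) ^ (Suc m + 1) * exp (1 - real (Suc m))"
    by (simp add: add.commute)
  finally show ?case .
qed simp

lemma power_diff_ge:
  fixes a b :: real
  assumes "0 \<le> b" "b \<le> a"
  shows "(a - b) * a ^ m \<le> a ^ Suc m - b ^ Suc m"
proof -
  have "b * b ^ m \<le> b * a ^ m"
    using assms by (intro mult_left_mono power_mono) auto
  then show ?thesis by (simp add: algebra_simps)
qed

text \<open>The interval for the row sum has relative width \<open>1 / m\<^sup>2\<close>, so by
  \<open>power_diff_ge\<close> the shell keeps at least that fraction of the simplex. The factorial
  estimate costs one more factor \<open>m\<close>.\<close>

lemma row_volume_ge:
  fixes m :: nat and N :: real
  assumes m: "m \<ge> 1" and N: "N > 0"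
  shows "exp (real m - 1) / (N ^ m * real m ^ 3) \<le>
    ((real m / N) ^ m - ((real m - 1 / real m) / N) ^ m) / fact m"
proof -
  obtain m' where m': "m = Suc m'" using m by (cases m) auto
  have "real m ^ m / (real m)\<^sup>2 = (1 / real m) * real m ^ m'"
    using m by (simp add: m' power2_eq_square)
  also have "\<dots> \<le> real m ^ m - (real m - 1 / real m) ^ m"
    using power_diff_ge[of "real m - 1 / real m" "real m" m'] m
    by (simp add: m' field_simps)
  finally have 1: "real m ^ m / (real m)\<^sup>2 \<le> real m ^ m - (real m - 1 / real m) ^ m" .
  have "exp (real m - 1) / (N ^ m * real m ^ 3) * fact m \<le>
      exp (real m - 1) / (N ^ m * real m ^ 3) * (real m ^ (m + 1) * exp (1 - real m))"
    using N by (intro mult_left_mono fact_le_exp m) auto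
  also have "\<dots> = (real m ^ m / (real m)\<^sup>2) / N ^ m"
    using m N by (simp add: field_simps exp_diff power2_eq_square power3_eq_cube)
  also have "\<dots> \<le> (real m ^ m - (real m - 1 / real m) ^ m) / N ^ m"
    using N by (intro divide_right_mono 1) auto
  also have "\<dots> = (real m / N) ^ m - ((real m - 1 / real m) / N) ^ m"
    unfolding power_divide by (rule diff_divide_distrib)
  finally show ?thesis by (simp add: field_simps)
qed

section \<open>Upper-left blocks of doubly stochastic matrices\<close>

text \<open>The inequalities say that the completed matrix of order \<open>m + 1\<close> is
  nonnegative: in the block, in the last column, in the last row and in the corner, in this
  order.\<close>

definition block_polytope :: "nat \<Rightarrow> (nat \<times> nat \<Rightarrow> real) set" where
  "block_polytope m =
     {A \<in> extensional (matrix_index m).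
        (\<forall>i<m. \<forall>j<m. 0 \<le> A (i, j)) \<and>
        (\<forall>i<m. (\<Sum>j<m. A (i, j)) \<le> 1) \<and>
        (\<forall>j<m. (\<Sum>i<m. A (i, j)) \<le> 1) \<and>
        real m - 1 \<le> (\<Sum>i<m. \<Sum>j<m. A (i, j))}"

lemma finite_matrix_index [simp]: "finite (matrix_index m)"
  by (simp add: matrix_index_def)

lemma sets_matrix_lborel: "sets (matrix_lborel m) = sets (matrix_borel m)"
  by (intro sets_PiM_cong) auto

lemma space_matrix_borel: "space (matrix_borel m) = extensional (matrix_index m)"
  by (simp add: space_PiM PiE_UNIV_domain PiE_def)

lemma sets_block_polytope [measurable]: "block_polytope m \<in> sets (matrix_borel m)"
proof -
  have [measurable]: "(\<lambda>A. A (i, j)) \<in> borel_measurable (matrix_borel m)" if "i < m" "j < m" for i j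
    using measurable_component_singleton[of "(i, j)" "matrix_index m" "\<lambda>_. borel :: real measure"] that
    by (simp add: matrix_index_def)
  have "block_polytope m = {A \<in> space (matrix_borel m).
        (\<forall>i\<in>{..<m}. \<forall>j\<in>{..<m}. 0 \<le> A (i, j)) \<and>
        (\<forall>i\<in>{..<m}. (\<Sum>j\<in>{..<m}. A (i, j)) \<le> 1) \<and>
        (\<forall>j\<in>{..<m}. (\<Sum>i\<in>{..<m}. A (i, j)) \<le> 1) \<and>
        real m - 1 \<le> (\<Sum>i\<in>{..<m}. \<Sum>j\<in>{..<m}. A (i, j))}"
    unfolding block_polytope_def space_matrix_borel by auto
  also have "\<dots> \<in> sets (matrix_borel m)"
    by measurable
  finally show ?thesis .
qed

text \<open>The volume of one row is raised to the power \<open>m\<close> and divided by the number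
  \<open>(m\<^sup>2 + 1) ^ m\<close> of column vectors. The unit is \<open>1 / (m + 1)\<close>, so
  the constant bound of \<open>m + 1\<close> units is a column sum of at most 1.\<close>

lemma emeasure_block_polytope_ge:
  assumes m: "m \<ge> 1"
  shows "ennreal (exp (real m - 1) ^ m / ((real m + 1) ^ m * real m ^ 3 * (real m ^ 2 + 1)) ^ m) \<le>
    emeasure (matrix_lborel m) (block_polytope m)"
proof -
  define N where "N = real m + 1"
  \<comment> \<open>Row sums at least \<open>(m - 1/m) / N\<close> make the total at least \<open>m - 1\<close>.\<close>
  define T where "T = {(real m - 1 / real m) / N<..real m / N}"
  let ?L = "row_bounded_matrices {..<m} {..<m} T"
  let ?W = "column_bounded_matrices {..<m} {..<m} T (\<lambda>j. real (m + 1) * (1 / N))"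
  let ?r = "((real m / N) ^ m - ((real m - 1 / real m) / N) ^ m) / fact m"
  have N: "N > 0" by (simp add: N_def)
  have "1 / real m \<le> 1" "1 \<le> real m" "0 \<le> 1 / real m"
    using m by auto
  then have h: "0 \<le> real m - 1 / real m" "real m - 1 / real m \<le> real m"
    by linarith+
  have r: "exp (real m - 1) / (N ^ m * real m ^ 3) \<le> ?r"
    by (rule row_volume_ge[OF m N])
  have sub: "?W \<subseteq> block_polytope m"
  proof
    fix A assume A: "A \<in> ?W"
    have "(\<Sum>j<m. A (i, j)) \<in> T" if "i < m" for i
      using A that by (auto simp: column_bounded_matrices_def)
    then have row: "(real m - 1 / real m) / N \<le> (\<Sum>j<m. A (i, j))" "(\<Sum>j<m. A (i, j)) \<le> real m / N"
      if "i < m" for i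
      using that by (force simp: T_def)+
    have "real m / N \<le> 1"
      by (simp add: N_def)
    then have "(\<Sum>j<m. A (i, j)) \<le> 1" if "i < m" for i
      using row(2)[OF that] by linarith
    moreover have "(\<Sum>i<m. A (i, j)) \<le> 1" if "j < m" for j
      using A that N by (auto simp: column_bounded_matrices_def N_def add.commute)
    moreover have "real m - 1 \<le> (\<Sum>i<m. \<Sum>j<m. A (i, j))"
    proof -
      have "real m - 1 / real m = (real m - 1) * N / real m"
        using m by (simp add: N_def field_simps)
      then have "real m - 1 = real m * ((real m - 1 / real m) / N)"
        using m N by simp
      also have "\<dots> = (\<Sum>i<m. (real m - 1 / real m) / N)"
        by simp
      also have "\<dots> \<le> (\<Sum>i<m. \<Sum>j<m. A (i, j))"
        using row by (intro sum_mono) auto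
      finally show ?thesis .
    qed
    ultimately show "A \<in> block_polytope m"
      using A by (auto simp: block_polytope_def column_bounded_matrices_def space_PiM matrix_index_def
          PiE_def)
  qed
  have "ennreal ((exp (real m - 1) / (N ^ m * real m ^ 3)) ^ m) \<le> ennreal (?r ^ m)"
    using r N by (intro ennreal_leI power_mono) auto
  also have "\<dots> = ennreal ?r ^ m"
    using r N by (subst ennreal_power) (auto intro: order_trans[rotated])
  also have "\<dots> = emeasure (PiM ({..<m} \<times> {..<m}) (\<lambda>_. lborel)) ?L"
    unfolding T_def using m h N by (subst emeasure_row_bounded_matrices) (auto simp: divide_right_mono lessThan_empty_iff)
  \<comment> \<open>Here \<open>K\<close> is \<open>m\<^sup>2\<close>: the entries sum to at most
    \<open>m * (m / N)\<close>, that is \<open>m\<^sup>2\<close> units, and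
    \<open>m\<^sup>2 + m = m * (m + 1)\<close> leaves exactly the room needed for rounding.\<close>
  also have "\<dots> \<le> of_nat ((m\<^sup>2 + 1) ^ card {..<m}) * emeasure (PiM ({..<m} \<times> {..<m}) (\<lambda>_. lborel)) ?W"
    by (rule emeasure_row_bounded_le_column_bounded[where \<tau> = "real m / N"])
      (use N in \<open>auto simp: T_def power2_eq_square algebra_simps\<close>)
  also have "\<dots> \<le> of_nat ((m\<^sup>2 + 1) ^ m) * emeasure (matrix_lborel m) (block_polytope m)"
    unfolding matrix_index_def[symmetric] using sub sets_block_polytope[of m]
    by (intro mult_mono emeasure_mono) (auto simp: sets_matrix_lborel)
  finally have le: "ennreal ((exp (real m - 1) / (N ^ m * real m ^ 3)) ^ m) \<le>
      ennreal (real ((m\<^sup>2 + 1) ^ m)) * emeasure (matrix_lborel m) (block_polytope m)"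
    by (simp add: ennreal_of_nat_eq_real_of_nat)
  define a where "a = real ((m\<^sup>2 + 1) ^ m)"
  have a: "a > 0" unfolding a_def of_nat_0_less_iff by simp
  have "ennreal (1 / a) * ennreal ((exp (real m - 1) / (N ^ m * real m ^ 3)) ^ m) \<le>
      ennreal (1 / a) * (ennreal a * emeasure (matrix_lborel m) (block_polytope m))"
    using le unfolding a_def by (intro mult_left_mono) auto
  also have "\<dots> = emeasure (matrix_lborel m) (block_polytope m)"
    using a by (simp add: mult.assoc[symmetric] flip: ennreal_mult)
  also have "ennreal (1 / a) * ennreal ((exp (real m - 1) / (N ^ m * real m ^ 3)) ^ m) =
     ennreal (1 / a * (exp (real m - 1) / (N ^ m * real m ^ 3)) ^ m)"
    using a N by (intro ennreal_mult[symmetric]) auto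
  also have "1 / a * (exp (real m - 1) / (N ^ m * real m ^ 3)) ^ m =
    exp (real m - 1) ^ m / ((real m + 1) ^ m * real m ^ 3 * (real m ^ 2 + 1)) ^ m"
    unfolding a_def N_def by (simp add: power_divide power_mult_distrib mult.commute add.commute)
  finally show ?thesis .
qed

text \<open>The sum conditions force the last column, the last row and then the corner, which is the
  total of the block minus \<open>m - 1\<close> whether computed along its row or its column. Hence
  a block can be completed exactly when the forced entries are nonnegative.\<close>

lemma block_image_birkhoff_polytope:
  "upper_left_block m ` birkhoff_polytope (Suc m) = block_polytope m"
proof (intro equalityI subsetI)
  fix B assume "B \<in> upper_left_block m ` birkhoff_polytope (Suc m)"
  then obtain A where A: "A \<in> birkhoff_polytope (Suc m)" and B: "B = upper_left_block m A"
    by auto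
  have nonneg: "0 \<le> A (i, j)" if "i \<le> m" "j \<le> m" for i j
    using A that by (auto simp: birkhoff_polytope_def)
  have row: "(\<Sum>j<m. A (i, j)) + A (i, m) = 1" if "i \<le> m" for i
    using A that by (auto simp: birkhoff_polytope_def)
  have col: "(\<Sum>i<m. A (i, j)) + A (m, j) = 1" if "j \<le> m" for j
    using A that by (auto simp: birkhoff_polytope_def)
  have BA: "B (i, j) = A (i, j)" if "i < m" "j < m" for i j
    using that by (simp add: B upper_left_block_def matrix_index_def)
  have "(\<Sum>i<m. \<Sum>j<m. A (i, j)) = (\<Sum>i<m. 1 - A (i, m))"
    using row by (intro sum.cong) (auto simp: eq_diff_eq)
  also have "\<dots> = real m - 1 + A (m, m)"
    using col[of m] by (simp add: sum_subtractf)
  finally have "real m - 1 \<le> (\<Sum>i<m. \<Sum>j<m. A (i, j))"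
    using nonneg[of m m] by simp
  moreover have "(\<Sum>j<m. A (i, j)) \<le> 1" if "i < m" for i
    using row[of i] nonneg[of i m] that by simp
  moreover have "(\<Sum>i<m. A (i, j)) \<le> 1" if "j < m" for j
    using col[of j] nonneg[of m j] that by simp
  ultimately show "B \<in> block_polytope m"
    using nonneg BA by (auto simp: block_polytope_def) (simp add: B upper_left_block_def)
next
  fix B assume B: "B \<in> block_polytope m"
  define A where "A = (\<lambda>(i, j)\<in>matrix_index (Suc m).
     if i < m \<and> j < m then B (i, j)
     else if i < m then 1 - (\<Sum>j<m. B (i, j))
     else if j < m then 1 - (\<Sum>i<m. B (i, j))
     else (\<Sum>i<m. \<Sum>j<m. B (i, j)) - (real m - 1))"
  have A1: "A (i, j) = B (i, j)" if "i < m" "j < m" for i j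
    using that by (simp add: A_def matrix_index_def)
  have A2: "A (i, m) = 1 - (\<Sum>j<m. B (i, j))" if "i < m" for i
    using that by (simp add: A_def matrix_index_def)
  have A3: "A (m, j) = 1 - (\<Sum>i<m. B (i, j))" if "j < m" for j
    using that by (simp add: A_def matrix_index_def)
  have A4: "A (m, m) = (\<Sum>i<m. \<Sum>j<m. B (i, j)) - (real m - 1)"
    by (simp add: A_def matrix_index_def)
  have "A \<in> birkhoff_polytope (Suc m)"
    unfolding birkhoff_polytope_def
  proof (intro CollectI conjI allI impI)
    show "A \<in> extensional (matrix_index (Suc m))"
      by (simp add: A_def)
    show "0 \<le> A (i, j)" if "i < Suc m" "j < Suc m" for i j
      using B that by (cases "i = m"; cases "j = m") (auto simp: block_polytope_def A1 A2 A3 A4)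
    show "(\<Sum>j<Suc m. A (i, j)) = 1" if "i < Suc m" for i
    proof (cases "i = m")
      case True
      have "(\<Sum>j<m. A (m, j)) = real m - (\<Sum>i<m. \<Sum>j<m. B (i, j))"
        by (subst sum.swap) (simp add: A3 sum_subtractf)
      then show ?thesis by (simp add: True A4)
    qed (use that in \<open>simp add: A1 A2\<close>)
    show "(\<Sum>i<Suc m. A (i, j)) = 1" if "j < Suc m" for j
    proof (cases "j = m")
      case True
      have "(\<Sum>i<m. A (i, m)) = real m - (\<Sum>i<m. \<Sum>j<m. B (i, j))"
        by (simp add: A2 sum_subtractf)
      then show ?thesis by (simp add: True A4)
    qed (use that in \<open>simp add: A1 A3\<close>)
  qed
  moreover have "B = upper_left_block m A"
  proof
    fix p show "B p = upper_left_block m A p"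
      using B by (cases p) (auto simp: upper_left_block_def matrix_index_def A1 block_polytope_def
          extensional_def restrict_def)
  qed
  ultimately show "B \<in> upper_left_block m ` birkhoff_polytope (Suc m)"
    by blast
qed

subsection \<open>Comparison with independent exponential entries\<close>

abbreviation exponential_law :: "real \<Rightarrow> real measure" where
  "exponential_law l \<equiv> density lborel (exponential_density l)"

abbreviation exponential_matrix_law :: "nat \<Rightarrow> real \<Rightarrow> (nat \<times> nat \<Rightarrow> real) measure" where
  "exponential_matrix_law m l \<equiv> PiM (matrix_index m) (\<lambda>_. exponential_law l)"

lemma sets_exponential_matrix_law: "sets (exponential_matrix_law m l) = sets (matrix_borel m)"
  by (intro sets_PiM_cong) auto

lemma space_exponential_matrix_law: "space (exponential_matrix_law m l) = space (matrix_borel m)"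
  by (intro sets_eq_imp_space_eq sets_exponential_matrix_law)

lemma prob_space_exponential_matrix_law: "l > 0 \<Longrightarrow> prob_space (exponential_matrix_law m l)"
  by (intro prob_space_PiM prob_space_exponential_density)

text \<open>Both sides are compared on boxes, where the integral of the product factorizes.\<close>

lemma density_PiM_lborel:
  fixes f :: "real \<Rightarrow> ennreal"
  assumes I: "finite I" and f [measurable]: "f \<in> borel_measurable borel"
    and "sigma_finite_measure (density lborel f)"
  shows "density (PiM I (\<lambda>_. lborel)) (\<lambda>x. \<Prod>i\<in>I. f (x i)) = PiM I (\<lambda>_. density lborel f)"
proof -
  interpret D: product_sigma_finite "\<lambda>_. density lborel f"
    using assms by (simp add: product_sigma_finite_def)
  show ?thesis
  proof (rule D.PiM_eqI[OF I])
    show "sets (density (PiM I (\<lambda>_. lborel)) (\<lambda>x. \<Prod>i\<in>I. f (x i))) = PiM I (\<lambda>_. density lborel f)"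
      by (simp cong: sets_PiM_cong)
    fix A :: "'a \<Rightarrow> real set" assume A: "\<And>i. i \<in> I \<Longrightarrow> A i \<in> sets (density lborel f)"
    have box: "PiE I A \<in> sets (PiM I (\<lambda>_. lborel))"
      using I A by (intro sets_PiM_I_finite) auto
    have [measurable]: "(\<lambda>x. x i) \<in> borel_measurable (PiM I (\<lambda>_. lborel :: real measure))" if "i \<in> I" for i
      using measurable_component_singleton[OF that, of "\<lambda>_. lborel :: real measure"] by simp
    have "emeasure (density (PiM I (\<lambda>_. lborel)) (\<lambda>x. \<Prod>i\<in>I. f (x i))) (PiE I A) =
        (\<integral>\<^sup>+x. (\<Prod>i\<in>I. f (x i)) * indicator (PiE I A) x \<partial>PiM I (\<lambda>_. lborel))"
      using box by (intro emeasure_density) auto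
    also have "\<dots> = (\<integral>\<^sup>+x. (\<Prod>i\<in>I. f (x i) * indicator (A i) (x i)) \<partial>PiM I (\<lambda>_. lborel))"
    proof (intro nn_integral_cong)
      fix x :: "'a \<Rightarrow> real" assume "x \<in> space (PiM I (\<lambda>_. lborel))"
      then have "indicator (PiE I A) x = (\<Prod>i\<in>I. indicator (A i) (x i) :: ennreal)"
        using I by (auto simp: indicator_def space_PiM PiE_def Pi_def)
      then show "(\<Prod>i\<in>I. f (x i)) * indicator (PiE I A) x = (\<Prod>i\<in>I. f (x i) * indicator (A i) (x i))"
        by (simp add: prod.distrib)
    qed
    also have "\<dots> = (\<Prod>i\<in>I. \<integral>\<^sup>+x. f x * indicator (A i) x \<partial>lborel)"
      using I A by (intro lborel_product.product_nn_integral_prod) auto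
    also have "\<dots> = (\<Prod>i\<in>I. emeasure (density lborel f) (A i))"
      using A by (intro prod.cong refl emeasure_density[symmetric]) auto
    finally show "emeasure (density (PiM I (\<lambda>_. lborel)) (\<lambda>x. \<Prod>i\<in>I. f (x i))) (PiE I A) =
      (\<Prod>i\<in>I. emeasure (density lborel f) (A i))" .
  qed
qed

text \<open>The joint density depends only on the total of the entries, which is what makes it
  bounded below on the polytope.\<close>

lemma prod_exponential_density:
  assumes "\<And>i. i \<in> I \<Longrightarrow> 0 \<le> x i"
  shows "(\<Prod>i\<in>I. exponential_density l (x i)) = l ^ card I * exp (- l * (\<Sum>i\<in>I. x i))"
proof -
  have "(\<Prod>i\<in>I. exponential_density l (x i)) = (\<Prod>i\<in>I. l * exp (- l * x i))"
    using assms by (intro prod.cong) (simp_all add: exponential_density_def mult.commute leD)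
  also have "\<dots> = l ^ card I * exp (- l * (\<Sum>i\<in>I. x i))"
    by (cases "finite I") (simp_all add: prod.distrib exp_sum sum_distrib_left)
  finally show ?thesis .
qed

lemma ennreal_inverse_antimono: "a \<le> b \<Longrightarrow> inverse b \<le> inverse (a :: ennreal)"
  using ereal_inverse_antimono[of "enn2ereal a" "enn2ereal b"]
  by (simp add: less_eq_ennreal.rep_eq inverse_ennreal.rep_eq)

text \<open>This is \<open>1 / (v * d)\<close> for the volume bound \<open>v\<close> and the density
  bound \<open>d\<close> in the proof below. The powers of \<open>m + 1\<close> cancel, and
  \<open>m * (m + 1) - m * (m - 1) = 2 * m\<close> is left in the exponent.\<close>

definition density_bound :: "nat \<Rightarrow> real" where
  "density_bound m = exp (2 * real m) * (real m ^ 3 * (real m ^ 2 + 1)) ^ m"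

text \<open>The rate \<open>m + 1\<close> matches the average entry \<open>1 / (m + 1)\<close> of a
  doubly stochastic matrix. On the polytope the total is at most \<open>m\<close>, so the
  exponential density is at least \<open>d\<close> there, while the uniform density is at most
  \<open>1 / v\<close>.\<close>

lemma uniform_block_polytope_le_exponential:
  assumes m: "m \<ge> 1" and E: "E \<in> sets (matrix_borel m)"
  shows "emeasure (uniform_measure (matrix_lborel m) (block_polytope m)) E \<le>
    ennreal (density_bound m) * emeasure (exponential_matrix_law m (real m + 1)) E"
proof -
  let ?P = "block_polytope m" and ?L = "matrix_lborel m"
  define N where "N = real m + 1"
  define d where "d = N ^ (m * m) * exp (- N * real m)"
  define v where "v = exp (real m - 1) ^ m / ((real m + 1) ^ m * real m ^ 3 * (real m ^ 2 + 1)) ^ m"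
  have N: "N > 0" by (simp add: N_def)
  have d: "d > 0" unfolding d_def using N by simp
  have "real m ^ 2 + 1 > 0" by (simp add: add_nonneg_pos)
  then have v: "v > 0" unfolding v_def using m by simp
  have P: "?P \<in> sets ?L" and EL: "E \<in> sets ?L"
    using sets_block_polytope[of m] E by (simp_all add: sets_matrix_lborel)
  have [measurable]: "(\<lambda>x. x p) \<in> borel_measurable ?L" if "p \<in> matrix_index m" for p
    using measurable_component_singleton[OF that, of "\<lambda>_. lborel :: real measure"] by simp
  have eq: "exponential_matrix_law m N =
      density ?L (\<lambda>x. \<Prod>p\<in>matrix_index m. ennreal (exponential_density N (x p)))"
    using prob_space_exponential_density[OF N]
    by (intro density_PiM_lborel[symmetric]) (auto intro: prob_space_imp_sigma_finite)
  have lower: "ennreal d \<le> (\<Prod>p\<in>matrix_index m. ennreal (exponential_density N (A p)))"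
    if A: "A \<in> ?P" for A
  proof -
    have "(\<Sum>p\<in>matrix_index m. A p) = (\<Sum>i<m. \<Sum>j<m. A (i, j))"
      by (simp add: matrix_index_def sum.cartesian_product)
    also have "\<dots> \<le> (\<Sum>i<m. 1)"
      using A by (intro sum_mono) (auto simp: block_polytope_def)
    finally have total: "(\<Sum>p\<in>matrix_index m. A p) \<le> real m"
      by simp
    have "d \<le> N ^ (m * m) * exp (- N * (\<Sum>p\<in>matrix_index m. A p))"
      unfolding d_def using total N by (intro mult_left_mono) auto
    also have "\<dots> = (\<Prod>p\<in>matrix_index m. exponential_density N (A p))"
      using A by (subst prod_exponential_density)
        (auto simp: matrix_index_def block_polytope_def)
    finally show ?thesis
      using N by (subst prod_ennreal) (auto intro: exponential_density_nonneg ennreal_leI)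
  qed
  have "ennreal d * emeasure ?L (?P \<inter> E) = (\<integral>\<^sup>+A. ennreal d * indicator (?P \<inter> E) A \<partial>?L)"
    using P EL by (subst nn_integral_cmult_indicator) auto
  also have "\<dots> \<le> (\<integral>\<^sup>+A. (\<Prod>p\<in>matrix_index m. ennreal (exponential_density N (A p))) * indicator E A \<partial>?L)"
    using lower by (intro nn_integral_mono) (auto simp: indicator_def)
  also have "\<dots> = emeasure (exponential_matrix_law m N) E"
    unfolding eq using EL by (intro emeasure_density[symmetric]) auto
  finally have le: "ennreal d * emeasure ?L (?P \<inter> E) \<le> emeasure (exponential_matrix_law m N) E" .
  have vol: "ennreal v \<le> emeasure ?L ?P"
    unfolding v_def by (rule emeasure_block_polytope_ge[OF m])
  have "emeasure (uniform_measure ?L ?P) E = emeasure ?L (?P \<inter> E) / emeasure ?L ?P"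
    by (rule emeasure_uniform_measure[OF P EL])
  also have "\<dots> \<le> emeasure ?L (?P \<inter> E) / ennreal v"
    using vol unfolding divide_ennreal_def by (intro mult_left_mono) (auto simp: ennreal_inverse_antimono)
  also have "\<dots> = ennreal (1 / (v * d)) * (ennreal d * emeasure ?L (?P \<inter> E))"
  proof -
    have "ennreal (1 / (v * d)) * (ennreal d * x) = x / ennreal v" for x :: ennreal
    proof -
      have "ennreal (1 / (v * d)) * (ennreal d * x) = ennreal (1 / (v * d) * d) * x"
        using v d by (subst ennreal_mult) (auto simp: mult.assoc)
      also have "1 / (v * d) * d = 1 / v"
        using d by simp
      also have "ennreal (1 / v) = 1 / ennreal v"
        using v by (metis divide_ennreal ennreal_1 zero_le_one)
      finally show ?thesis by (simp add: ennreal_times_divide mult.commute)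
    qed
    then show ?thesis by simp
  qed
  also have "\<dots> \<le> ennreal (1 / (v * d)) * emeasure (exponential_matrix_law m N) E"
    by (intro mult_left_mono le) auto
  also have "1 / (v * d) = density_bound m"
  proof -
    have "exp (real m - 1) ^ m * exp (- N * real m) * exp (2 * real m) = 1"
      unfolding exp_of_nat_mult[symmetric] exp_add[symmetric] N_def by (simp add: algebra_simps)
    then have one: "exp (2 * real m) * (exp (real m - 1) ^ m * exp (- N * real m)) = 1"
      by (simp add: mult.commute)
    have "v * d * (real m ^ 3 * (real m ^ 2 + 1)) ^ m = exp (real m - 1) ^ m * exp (- N * real m)"
    proof -
      define w where "w = real m ^ 3 * (real m ^ 2 + 1)"
      have w: "w > 0" using \<open>real m ^ 2 + 1 > 0\<close> m unfolding w_def by simp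
      have "v = exp (real m - 1) ^ m / (N ^ m * w) ^ m"
        unfolding v_def N_def w_def by (simp only: mult.assoc)
      then have "v * d * w ^ m = exp (real m - 1) ^ m * exp (- N * real m)"
        using w N unfolding d_def by (simp add: power_mult power_mult_distrib)
      then show ?thesis unfolding w_def .
    qed
    then have "exp (2 * real m) * (v * d * (real m ^ 3 * (real m ^ 2 + 1)) ^ m) = 1"
      using one by simp
    then have "density_bound m * (v * d) = 1"
      unfolding density_bound_def by (simp only: mult_ac)
    then show ?thesis
      using v d by (simp add: field_simps)
  qed
  finally show ?thesis unfolding N_def .
qed

lemma distr_exponential_law_scale:
  assumes l: "l > 0"
  shows "distr (exponential_law l) (exponential_law 1) (\<lambda>x. l * x) = exponential_law 1"
proof (rule measure_eqI)
  fix A assume A: "A \<in> sets (distr (exponential_law l) (exponential_law 1) (\<lambda>x. l * x))"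
  then have [measurable]: "A \<in> sets borel" by simp
  have vim: "(\<lambda>x. l * x) -` A \<in> sets borel"
    using measurable_sets[of "\<lambda>x. l * x" borel borel A] by simp
  have "emeasure (exponential_law 1) A = (\<integral>\<^sup>+x. ennreal (exponential_density 1 x) * indicator A x \<partial>lborel)"
    by (intro emeasure_density) auto
  also have "\<dots> = ennreal \<bar>l\<bar> * (\<integral>\<^sup>+x. ennreal (exponential_density 1 (0 + l * x)) * indicator A (0 + l * x) \<partial>lborel)"
    using l by (intro nn_integral_real_affine) auto
  also have "\<dots> = (\<integral>\<^sup>+x. ennreal (exponential_density l x) * indicator ((\<lambda>x. l * x) -` A) x \<partial>lborel)"
    using l by (subst nn_integral_cmult[symmetric])
      (auto intro!: nn_integral_cong simp: indicator_def exponential_density_def mult_less_0_iff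
        mult.commute ennreal_mult[symmetric])
  also have "\<dots> = emeasure (exponential_law l) ((\<lambda>x. l * x) -` A)"
    using vim by (intro emeasure_density[symmetric]) auto
  also have "\<dots> = emeasure (distr (exponential_law l) (exponential_law 1) (\<lambda>x. l * x)) A"
    by (subst emeasure_distr) auto
  finally show "emeasure (distr (exponential_law l) (exponential_law 1) (\<lambda>x. l * x)) A =
    emeasure (exponential_law 1) A" by simp
qed simp

section \<open>Transfer of concentration to a dominated law\<close>

text \<open>Under \<open>M\<close> the average of the indicators concentrates at \<open>p\<close>,
  and domination makes a large deviation unlikely under \<open>R\<close> as well. Under
  \<open>R\<close> that average has mean \<open>r\<close>, so \<open>r\<close> must be close to
  \<open>p\<close>; independence is used only under \<open>M\<close>.\<close>

lemma (in prob_space) Hoeffding_transfer: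
  fixes R :: "'a measure" and E :: "'i \<Rightarrow> 'a set" and p r K \<epsilon> :: real
  assumes R: "prob_space R" "sets R = sets M"
    and dom: "\<And>A. A \<in> sets M \<Longrightarrow> measure R A \<le> K * prob A"
    and I: "finite I" "I \<noteq> {}"
    and indep: "indep_vars (\<lambda>_. borel) (\<lambda>i. indicator (E i) :: 'a \<Rightarrow> real) I"
    and E: "\<And>i. i \<in> I \<Longrightarrow> E i \<in> sets M"
    and p: "\<And>i. i \<in> I \<Longrightarrow> prob (E i) = p"
    and r: "\<And>i. i \<in> I \<Longrightarrow> measure R (E i) = r"
    and \<epsilon>: "\<epsilon> \<ge> 0" and K: "K \<ge> 0"
  shows "\<bar>r - p\<bar> \<le> \<epsilon> + K * (2 * exp (- 2 * real (card I) * \<epsilon>\<^sup>2))"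
proof -
  interpret R: prob_space R by fact
  define c where "c = real (card I)"
  have c: "c > 0" unfolding c_def using I by (simp add: card_gt_0_iff)
  have spR: "space R = space M" by (rule sets_eq_imp_space_eq[OF R(2)])
  interpret H: Hoeffding_ineq M I "\<lambda>i. indicator (E i)" "\<lambda>_. 0" "\<lambda>_. 1" "c * p"
    by unfold_locales (use I indep E p in \<open>auto simp: indicator_def c_def sum.cong\<close>)
  define S where "S x = (\<Sum>i\<in>I. indicator (E i) x :: real)" for x
  define B where "B = {x \<in> space M. \<bar>S x - c * p\<bar> \<ge> c * \<epsilon>}"
  have [measurable]: "S \<in> borel_measurable M"
    unfolding S_def using E by measurable
  have [measurable]: "S \<in> borel_measurable R"
    by (subst measurable_cong_sets[OF R(2) refl]) measurable
  have B [measurable]: "B \<in> sets M" unfolding B_def by measurable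
  have "prob B \<le> 2 * exp (- 2 * (c * \<epsilon>)\<^sup>2 / (\<Sum>i\<in>I. (1 - 0)\<^sup>2))"
    unfolding B_def S_def using c \<epsilon> by (intro H.Hoeffding_ineq_abs_ge) (auto simp: c_def)
  also have "- 2 * (c * \<epsilon>)\<^sup>2 / (\<Sum>i\<in>I. (1 - 0)\<^sup>2) = - 2 * c * \<epsilon>\<^sup>2"
    using c unfolding c_def by (simp add: power2_eq_square)
  finally have probB: "prob B \<le> 2 * exp (- 2 * c * \<epsilon>\<^sup>2)" .
  have p01: "0 \<le> p" "p \<le> 1"
    using I p by (metis all_not_in_conv measure_nonneg, metis all_not_in_conv prob_le_1)
  have S01: "0 \<le> S x" "S x \<le> c" for x
    unfolding S_def c_def using sum_bounded_above[of I "\<lambda>i. indicator (E i) x :: real" 1]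
    by (auto intro!: sum_nonneg simp: indicator_le_1)
  have intE: "integrable R (indicator (E i) :: 'a \<Rightarrow> real)" if "i \<in> I" for i
    using E[OF that] R.emeasure_finite R(2) by (intro integrable_real_indicator) (auto simp: less_top[symmetric])
  have intS: "integrable R S"
    unfolding S_def using intE by (intro Bochner_Integration.integrable_sum) auto
  have "R.expectation S = (\<Sum>i\<in>I. R.expectation (indicator (E i)))"
    unfolding S_def using intE by (intro Bochner_Integration.integral_sum) auto
  also have "\<dots> = (\<Sum>i\<in>I. r)"
    using E R(2) r by (intro sum.cong) (auto simp: spR sets.sets_into_space Int_absorb2)
  finally have ES: "R.expectation S = c * r" by (simp add: c_def)
  have intB: "integrable R (indicator B :: 'a \<Rightarrow> real)"
    using B R.emeasure_finite R(2) by (intro integrable_real_indicator) (auto simp: less_top[symmetric])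
  have "\<bar>c * r - c * p\<bar> = \<bar>R.expectation (\<lambda>x. S x - c * p)\<bar>"
    using intS by (simp add: ES R.prob_space)
  also have "\<dots> \<le> R.expectation (\<lambda>x. \<bar>S x - c * p\<bar>)"
    by (rule integral_abs_bound)
  also have "\<dots> \<le> R.expectation (\<lambda>x. c * \<epsilon> + c * indicator B x)"
  proof (rule integral_mono)
    \<comment> \<open>Off \<open>B\<close> the deviation is below \<open>c * \<epsilon>\<close>; on
      \<open>B\<close> it is at most \<open>c\<close>, as \<open>S x\<close> and
      \<open>c * p\<close> both lie between 0 and \<open>c\<close>.\<close>
    show "\<bar>S x - c * p\<bar> \<le> c * \<epsilon> + c * indicator B x" if "x \<in> space R" for x
    proof -
      have "0 \<le> c * p" "c * p \<le> c"
        using p01 c by auto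
      then have "\<bar>S x - c * p\<bar> \<le> c"
        using S01[of x] by linarith
      then show ?thesis
        using that c \<epsilon> unfolding B_def by (auto simp: spR indicator_def intro: add_increasing)
    qed
  qed (use intS intB in auto)
  also have "\<dots> = c * \<epsilon> + c * measure R B"
    using intB B R(2) R.prob_space by (simp add: spR sets.sets_into_space Int_absorb2)
  finally have "c * \<bar>r - p\<bar> \<le> c * (\<epsilon> + measure R B)"
    using c by (simp add: abs_mult flip: right_diff_distrib distrib_left)
  then have "\<bar>r - p\<bar> \<le> \<epsilon> + measure R B"
    using c by simp
  also have "measure R B \<le> K * prob B"
    by (rule dom[OF B])
  also have "\<dots> \<le> K * (2 * exp (- 2 * c * \<epsilon>\<^sup>2))"
    by (intro mult_left_mono probB K)
  finally show ?thesis unfolding c_def by simp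
qed

subsection \<open>Disjoint blocks\<close>

text \<open>The position \<open>(a, b)\<close> counts whole blocks. Reindexing to the corner puts
  all blocks in one space, so that the same event can be tested on each of them.\<close>

definition scaled_block :: "nat \<Rightarrow> real \<Rightarrow> nat \<Rightarrow> nat \<Rightarrow> (nat \<times> nat \<Rightarrow> real) \<Rightarrow> nat \<times> nat \<Rightarrow> real" where
  "scaled_block k c a b A = (\<lambda>p\<in>matrix_index k. c * A (a * k + fst p, b * k + snd p))"

lemma block_index_le: "a < m div k \<Longrightarrow> a * k + k \<le> (m :: nat)"
  using order_trans[OF mult_le_mono1[of "Suc a" "m div k" k] div_times_less_eq_dividend[of m k]]
  by (simp add: add.commute)

lemma block_index_less: "a < m div k \<Longrightarrow> i < k \<Longrightarrow> a * k + i < (m :: nat)"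
  using block_index_le[of a m k] by linarith

lemma measurable_scaled_block:
  assumes "a < m div k" "b < m div k"
  shows "scaled_block k c a b \<in> measurable (matrix_borel m) (matrix_borel k)"
proof -
  have [measurable]: "(\<lambda>A. A p) \<in> borel_measurable (matrix_borel m)" if "p \<in> matrix_index m" for p
    using measurable_component_singleton[OF that, of "\<lambda>_. borel :: real measure"] by simp
  have "(a * k + fst p, b * k + snd p) \<in> matrix_index m" if "p \<in> matrix_index k" for p
    using that assms by (auto simp: matrix_index_def block_index_less)
  then show ?thesis
    unfolding scaled_block_def by measurable
qed

text \<open>Reindexing along the injection \<open>t\<close> gives independent entries of rate
  \<open>l\<close>, and multiplying them by \<open>l\<close> gives rate 1.\<close>

lemma distr_scaled_block:
  assumes ab: "a < m div k" "b < m div k" and l: "l > 0"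
  shows "distr (exponential_matrix_law m l) (matrix_borel k) (scaled_block k l a b) =
    exponential_matrix_law k 1"
proof -
  define t where "t = (\<lambda>p. (a * k + fst p, b * k + snd p))"
  define r where "r = (\<lambda>A :: nat \<times> nat \<Rightarrow> real. \<lambda>p\<in>matrix_index k. A (t p))"
  have t: "inj_on t (matrix_index k)" "t \<in> matrix_index k \<rightarrow> matrix_index m"
    using ab by (auto simp: t_def inj_on_def matrix_index_def block_index_less prod_eq_iff)
  have distr_r: "distr (exponential_matrix_law m l) (exponential_matrix_law k l) r = exponential_matrix_law k l"
    unfolding r_def by (rule distr_PiM_reindex) (use t l in \<open>auto intro: prob_space_exponential_density\<close>)
  have [measurable]: "r \<in> measurable (exponential_matrix_law m l) (exponential_matrix_law k l)"
    unfolding r_def using t by (intro measurable_restrict measurable_component_singleton) auto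
  have [measurable]: "compose (matrix_index k) (\<lambda>x. l * x) \<in>
      measurable (exponential_matrix_law k l) (exponential_matrix_law k 1)"
  proof -
    have [measurable]: "(\<lambda>A. A p) \<in> borel_measurable (exponential_matrix_law k l)" if "p \<in> matrix_index k" for p
      using measurable_component_singleton[OF that, of "\<lambda>_. exponential_law l"] by simp
    have "(\<lambda>A. \<lambda>p\<in>matrix_index k. l * A p) \<in>
      measurable (exponential_matrix_law k l) (exponential_matrix_law k 1)"
      by (rule measurable_restrict) measurable
    then show ?thesis by (simp add: compose_def[abs_def])
  qed
  have "scaled_block k l a b = compose (matrix_index k) (\<lambda>x. l * x) \<circ> r"
    by (auto simp: scaled_block_def compose_def r_def t_def fun_eq_iff restrict_def)
  then have "distr (exponential_matrix_law m l) (matrix_borel k) (scaled_block k l a b) =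
    distr (exponential_matrix_law m l) (exponential_matrix_law k 1) (compose (matrix_index k) (\<lambda>x. l * x) \<circ> r)"
    by (intro distr_cong) (simp_all add: sets_exponential_matrix_law)
  also have "\<dots> = distr (distr (exponential_matrix_law m l) (exponential_matrix_law k l) r)
      (exponential_matrix_law k 1) (compose (matrix_index k) (\<lambda>x. l * x))"
    by (rule distr_distr[symmetric]) measurable
  also have "\<dots> = PiM (matrix_index k) (\<lambda>_. distr (exponential_law l) (exponential_law 1) (\<lambda>x. l * x))"
    unfolding distr_r using l
    by (intro distr_PiM_finite_prob_space') (auto intro: prob_space_exponential_density)
  also have "\<dots> = exponential_matrix_law k 1"
    by (simp add: distr_exponential_law_scale[OF l])
  finally show ?thesis .
qed

text \<open>The tuple of coordinates is the identity on the space, so its law is the product of its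
  marginals.\<close>

lemma indep_vars_PiM_coordinates:
  assumes "\<And>i. i \<in> I \<Longrightarrow> prob_space (M i)" and "I \<noteq> {}"
  shows "prob_space.indep_vars (PiM I M) M (\<lambda>i x. x i) I"
proof -
  interpret prob_space "PiM I M"
    using assms(1) by (rule prob_space_PiM)
  have "distr (PiM I M) (PiM I M) (\<lambda>x. \<lambda>i\<in>I. x i) = distr (PiM I M) (PiM I M) (\<lambda>x. x)"
    by (intro distr_cong) (auto simp: space_PiM)
  also have "\<dots> = PiM I (\<lambda>i. distr (PiM I M) (M i) (\<lambda>x. x i))"
    using assms by (auto simp: distr_PiM_component intro!: PiM_cong)
  finally show ?thesis
    using assms(2) by (subst indep_vars_iff_distr_eq_PiM') auto
qed

lemma (in prob_space) indep_vars_cong_on_space: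
  assumes eq: "\<And>i x. i \<in> I \<Longrightarrow> x \<in> space M \<Longrightarrow> X i x = Y i x"
  shows "indep_vars N X I \<longleftrightarrow> indep_vars N Y I"
proof -
  have "X i -` A \<inter> space M = Y i -` A \<inter> space M" if "i \<in> I" for i A
    using eq[OF that] by auto
  moreover have "X i \<in> measurable M (N i) \<longleftrightarrow> Y i \<in> measurable M (N i)" if "i \<in> I" for i
    using eq[OF that] by (rule measurable_cong)
  ultimately show ?thesis
    unfolding indep_vars_def by (auto cong: indep_sets_cong)
qed

text \<open>Distinct blocks are functions of disjoint groups of independent coordinates. Here
  \<open>J ab\<close> is the group read by block \<open>ab\<close>, and \<open>Y ab\<close> is the
  indicator as a function on that group.\<close>

lemma indep_vars_scaled_block:
  assumes m: "k \<ge> 1" "k \<le> m" and l: "l > 0" and B: "B \<in> sets (matrix_borel k)"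
  shows "prob_space.indep_vars (exponential_matrix_law m l) (\<lambda>_. borel)
     (\<lambda>ab. indicator ((\<lambda>A. scaled_block k l (fst ab) (snd ab) A) -` B \<inter> space (matrix_borel m))
        :: _ \<Rightarrow> real)
     (matrix_index (m div k))"
proof -
  let ?M = "exponential_matrix_law m l"
  interpret prob_space ?M by (rule prob_space_exponential_matrix_law[OF l])
  define t where "t ab p = (fst ab * k + fst p, snd ab * k + snd p)" for ab p :: "nat \<times> nat"
  define J where "J ab = t ab ` matrix_index k" for ab
  define Y where "Y ab y = (indicator B (\<lambda>p\<in>matrix_index k. l * y (t ab p)) :: real)"
    for ab and y :: "nat \<times> nat \<Rightarrow> real"
  have ne: "matrix_index m \<noteq> {}"
    using m by (auto simp: matrix_index_def lessThan_empty_iff)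
  have J: "J ab \<subseteq> matrix_index m" if "ab \<in> matrix_index (m div k)" for ab
    using that by (auto simp: J_def t_def matrix_index_def block_index_less)
  have disj: "disjoint_family_on J (matrix_index (m div k))"
  proof (unfold disjoint_family_on_def, intro ballI impI)
    fix ab cd :: "nat \<times> nat" assume neq: "ab \<noteq> cd"
    have "ab = cd" if "t ab p = t cd q" "p \<in> matrix_index k" "q \<in> matrix_index k" for p q
    proof -
      \<comment> \<open>Division by \<open>k\<close> recovers the block number from an absolute
        index, so distinct blocks share no entry.\<close>
      have "(x * k + i) div k = x" if "i < k" for x i :: nat
        using that by simp
      with that show ?thesis
        unfolding t_def matrix_index_def by (metis Pair_inject lessThan_iff mem_Times_iff prod_eqI)
    qed
    with neq show "J ab \<inter> J cd = {}" unfolding J_def by blast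
  qed
  have "indep_vars (\<lambda>ab. PiM (J ab) (\<lambda>_. exponential_law l)) (\<lambda>ab x. restrict (\<lambda>i. x i) (J ab))
      (matrix_index (m div k))"
    using J disj l ne
    by (intro indep_vars_restrict[OF indep_vars_PiM_coordinates])
      (auto intro: prob_space_exponential_density)
  then have "indep_vars (\<lambda>_. borel) (\<lambda>ab x. Y ab (restrict (\<lambda>i. x i) (J ab)) :: real) (matrix_index (m div k))"
  proof (rule indep_vars_compose2)
    fix ab assume "ab \<in> matrix_index (m div k)"
    have [measurable]: "(\<lambda>y. y (t ab p)) \<in> borel_measurable (PiM (J ab) (\<lambda>_. exponential_law l))"
      if "p \<in> matrix_index k" for p
      using measurable_component_singleton[of "t ab p" "J ab" "\<lambda>_. exponential_law l"] that
      by (simp add: J_def)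
    have 1: "(\<lambda>y. \<lambda>p\<in>matrix_index k. l * y (t ab p)) \<in>
        measurable (PiM (J ab) (\<lambda>_. exponential_law l)) (matrix_borel k)"
      by (rule measurable_restrict) measurable
    show "Y ab \<in> borel_measurable (PiM (J ab) (\<lambda>_. exponential_law l))"
      unfolding Y_def using B by (intro measurable_compose[OF 1]) auto
  qed
  moreover have "Y ab (restrict (\<lambda>i. x i) (J ab)) = indicator B (scaled_block k l (fst ab) (snd ab) x)"
    for ab x
  proof -
    have "(\<lambda>p\<in>matrix_index k. l * restrict (\<lambda>i. x i) (J ab) (t ab p)) = (\<lambda>p\<in>matrix_index k. l * x (t ab p))"
      by (rule restrict_ext) (simp add: J_def)
    also have "\<dots> = scaled_block k l (fst ab) (snd ab) x"
      by (simp add: scaled_block_def t_def)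
    finally show ?thesis unfolding Y_def by simp
  qed
  ultimately have "indep_vars (\<lambda>_. borel) (\<lambda>ab x. indicator B (scaled_block k l (fst ab) (snd ab) x) :: real)
      (matrix_index (m div k))"
    by simp
  then show ?thesis
    by (subst indep_vars_cong_on_space[where Y = "\<lambda>ab x. indicator B (scaled_block k l (fst ab) (snd ab) x)"])
      (auto simp: indicator_def space_exponential_matrix_law)
qed

section \<open>Exchangeability under the uniform law\<close>

text \<open>Exchanges the index intervals starting at 0 and at \<open>s\<close>. When these coincide
  or are disjoint the map is an involution, hence its own inverse.\<close>

definition block_swap :: "nat \<Rightarrow> nat \<Rightarrow> nat \<Rightarrow> nat" where
  "block_swap k s i = (if i < k then s + i else if s \<le> i \<and> i < s + k then i - s else i)"

lemma block_swap_block_swap: "s = 0 \<or> k \<le> s \<Longrightarrow> block_swap k s (block_swap k s i) = i"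
  by (auto simp: block_swap_def)

lemma block_swap_less: "i < m \<Longrightarrow> s + k \<le> m \<Longrightarrow> block_swap k s i < m"
  by (auto simp: block_swap_def)

text \<open>Permuting coordinates permutes the sides of a box and so preserves the product measure;
  permuting rows and columns also preserves the constraints of the polytope. For involutions no
  separate inverse has to be carried.\<close>

lemma emeasure_block_polytope_permute:
  fixes \<sigma> \<tau> :: "nat \<Rightarrow> nat"
  assumes \<sigma>: "\<And>i. i < m \<Longrightarrow> \<sigma> i < m" "\<And>i. i < m \<Longrightarrow> \<sigma> (\<sigma> i) = i"
    and \<tau>: "\<And>i. i < m \<Longrightarrow> \<tau> i < m" "\<And>i. i < m \<Longrightarrow> \<tau> (\<tau> i) = i"
    and E: "E \<in> sets (matrix_borel m)"
  defines "f \<equiv> \<lambda>A :: nat \<times> nat \<Rightarrow> real. \<lambda>p\<in>matrix_index m. A (\<sigma> (fst p), \<tau> (snd p))"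
  shows "emeasure (matrix_lborel m) (block_polytope m \<inter> (f -` E \<inter> space (matrix_borel m))) =
    emeasure (matrix_lborel m) (block_polytope m \<inter> E)"
proof -
  let ?L = "matrix_lborel m"
  define \<pi> where "\<pi> = (\<lambda>p. (\<sigma> (fst p), \<tau> (snd p)))"
  have \<pi>: "\<pi> p \<in> matrix_index m" "\<pi> (\<pi> p) = p" if "p \<in> matrix_index m" for p
    using that \<sigma> \<tau> by (auto simp: \<pi>_def matrix_index_def)
  have bij: "bij_betw \<pi> (matrix_index m) (matrix_index m)"
    by (rule bij_betwI[where g = \<pi>]) (use \<pi> in auto)
  have bij_\<sigma>: "bij_betw \<sigma> {..<m} {..<m}" and bij_\<tau>: "bij_betw \<tau> {..<m} {..<m}"
    by (rule bij_betwI[where g = \<sigma>], use \<sigma> in auto, rule bij_betwI[where g = \<tau>], use \<tau> in auto)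
  have f_eq: "f A = (\<lambda>p\<in>matrix_index m. A (\<pi> p))" for A
    by (simp add: f_def \<pi>_def)
  have f: "f \<in> measurable ?L ?L"
    unfolding f_eq[abs_def] using \<pi>(1) by (intro measurable_restrict measurable_component_singleton)
  have "distr ?L ?L f = ?L"
  proof (rule lborel_product.PiM_eqI)
    fix F :: "nat \<times> nat \<Rightarrow> real set" assume F: "\<And>p. p \<in> matrix_index m \<Longrightarrow> F p \<in> sets lborel"
    have "f -` PiE (matrix_index m) F \<inter> space ?L = PiE (matrix_index m) (F \<circ> \<pi>)"
    proof -
      have "A p \<in> F (\<pi> p)" if "\<forall>q\<in>matrix_index m. A (\<pi> q) \<in> F q" "p \<in> matrix_index m" for A :: "nat \<times> nat \<Rightarrow> real" and p
        using that \<pi>[OF that(2)] by metis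
      moreover have "A (\<pi> p) \<in> F p" if "\<forall>q\<in>matrix_index m. A q \<in> F (\<pi> q)" "p \<in> matrix_index m" for A :: "nat \<times> nat \<Rightarrow> real" and p
        using that \<pi>[OF that(2)] by metis
      ultimately show ?thesis
        unfolding f_eq by (auto simp: space_PiM PiE_iff)
    qed
    then have "emeasure (distr ?L ?L f) (PiE (matrix_index m) F) = emeasure ?L (PiE (matrix_index m) (F \<circ> \<pi>))"
      using f F by (subst emeasure_distr) (auto intro!: sets_PiM_I_finite)
    also have "\<dots> = (\<Prod>p\<in>matrix_index m. emeasure lborel (F (\<pi> p)))"
      using F \<pi> by (subst lborel_product.emeasure_PiM) auto
    also have "\<dots> = (\<Prod>p\<in>matrix_index m. emeasure lborel (F p))"
      using bij by (rule prod.reindex_bij_betw)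
    finally show "emeasure (distr ?L ?L f) (PiE (matrix_index m) F) =
      (\<Prod>p\<in>matrix_index m. emeasure lborel (F p))" .
  qed simp_all
  moreover have "f -` (block_polytope m \<inter> E) \<inter> space ?L =
      block_polytope m \<inter> (f -` E \<inter> space (matrix_borel m))"
  proof -
    have "f A \<in> block_polytope m \<longleftrightarrow> A \<in> block_polytope m" if A: "A \<in> extensional (matrix_index m)" for A
    proof -
      have fA: "f A (i, j) = A (\<sigma> i, \<tau> j)" if "i < m" "j < m" for i j
        using that by (simp add: f_def matrix_index_def)
      have row: "(\<Sum>j<m. f A (i, j)) = (\<Sum>j<m. A (\<sigma> i, j))" if "i < m" for i
        using that sum.reindex_bij_betw[OF bij_\<tau>, of "\<lambda>j. A (\<sigma> i, j)"] by (simp add: fA)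
      have col: "(\<Sum>i<m. f A (i, j)) = (\<Sum>i<m. A (i, \<tau> j))" if "j < m" for j
        using that sum.reindex_bij_betw[OF bij_\<sigma>, of "\<lambda>i. A (i, \<tau> j)"] by (simp add: fA)
      have total: "(\<Sum>i<m. \<Sum>j<m. f A (i, j)) = (\<Sum>i<m. \<Sum>j<m. A (i, j))"
        using sum.reindex_bij_betw[OF bij_\<sigma>, of "\<lambda>i. \<Sum>j<m. A (i, j)"] by (simp add: row)
      have all_\<sigma>: "(\<forall>i<m. P (\<sigma> i)) \<longleftrightarrow> (\<forall>i<m. P i)" for P
        using \<sigma> by metis
      have all_\<tau>: "(\<forall>i<m. P (\<tau> i)) \<longleftrightarrow> (\<forall>i<m. P i)" for P
        using \<tau> by metis
      have "(\<forall>i<m. \<forall>j<m. 0 \<le> f A (i, j)) \<longleftrightarrow> (\<forall>i<m. \<forall>j<m. 0 \<le> A (i, j))"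
        using all_\<sigma>[of "\<lambda>i. \<forall>j<m. 0 \<le> A (i, \<tau> j)"] all_\<tau>[of "\<lambda>j. 0 \<le> A (_, j)"] by (simp add: fA)
      moreover have "(\<forall>i<m. (\<Sum>j<m. f A (i, j)) \<le> 1) \<longleftrightarrow> (\<forall>i<m. (\<Sum>j<m. A (i, j)) \<le> 1)"
        using all_\<sigma>[of "\<lambda>i. (\<Sum>j<m. A (i, j)) \<le> 1"] by (simp add: row)
      moreover have "(\<forall>j<m. (\<Sum>i<m. f A (i, j)) \<le> 1) \<longleftrightarrow> (\<forall>j<m. (\<Sum>i<m. A (i, j)) \<le> 1)"
        using all_\<tau>[of "\<lambda>j. (\<Sum>i<m. A (i, j)) \<le> 1"] by (simp add: col)
      moreover have "f A \<in> extensional (matrix_index m)" by (simp add: f_def)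
      ultimately show ?thesis
        unfolding block_polytope_def using A by (simp only: mem_Collect_eq total simp_thms)
    qed
    moreover have "block_polytope m \<subseteq> extensional (matrix_index m)"
      by (auto simp: block_polytope_def)
    ultimately show ?thesis
      by (auto simp: space_PiM PiE_def)
  qed
  moreover have "block_polytope m \<inter> E \<in> sets ?L"
    using E by (simp add: sets_matrix_lborel sets_block_polytope sets.Int)
  ultimately show ?thesis
    using emeasure_distr[OF f, of "block_polytope m \<inter> E"] by simp
qed

text \<open>Swapping the first \<open>k\<close> rows with those of block row \<open>a\<close>, and
  likewise the columns for \<open>b\<close>, carries the block at \<open>(a, b)\<close> to the
  corner.\<close>

lemma measure_uniform_scaled_block:
  assumes ab: "a < m div k" "b < m div k" and B: "B \<in> sets (matrix_borel k)"
  shows "measure (uniform_measure (matrix_lborel m) (block_polytope m))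
      (scaled_block k c a b -` B \<inter> space (matrix_borel m)) =
    measure (uniform_measure (matrix_lborel m) (block_polytope m))
      (scaled_block k c 0 0 -` B \<inter> space (matrix_borel m))"
proof -
  define \<sigma> where "\<sigma> = block_swap k (a * k)"
  define \<tau> where "\<tau> = block_swap k (b * k)"
  define f where "f = (\<lambda>A :: nat \<times> nat \<Rightarrow> real. \<lambda>p\<in>matrix_index m. A (\<sigma> (fst p), \<tau> (snd p)))"
  let ?E = "scaled_block k c 0 0 -` B \<inter> space (matrix_borel m)"
  let ?E' = "scaled_block k c a b -` B \<inter> space (matrix_borel m)"
  \<comment> \<open>The two intervals that \<open>block_swap\<close> exchanges therefore coincide or
    are disjoint.\<close>
  have mult: "x * k = 0 \<or> k \<le> x * k" for x :: nat
    by (cases x) auto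
  have E: "?E \<in> sets (matrix_borel m)" "?E' \<in> sets (matrix_borel m)"
    using ab B by (auto intro!: measurable_sets measurable_scaled_block)
  have "f -` ?E \<inter> space (matrix_borel m) = ?E'"
  proof -
    have "scaled_block k c 0 0 (f A) = scaled_block k c a b A" for A
    proof
      fix p
      have "i < m" if "i < k" for i
        using that block_index_le[OF ab(1)] by linarith
      then show "scaled_block k c 0 0 (f A) p = scaled_block k c a b A p"
        by (auto simp: scaled_block_def f_def matrix_index_def \<sigma>_def \<tau>_def block_swap_def restrict_def)
    qed
    then show ?thesis
      by (auto simp: space_matrix_borel f_def)
  qed
  then have "emeasure (matrix_lborel m) (block_polytope m \<inter> ?E') = emeasure (matrix_lborel m) (block_polytope m \<inter> ?E)"
    using emeasure_block_polytope_permute[of m \<sigma> \<tau> ?E] E(1) block_index_le[OF ab(1)] block_index_le[OF ab(2)] mult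
    unfolding f_def by (simp add: \<sigma>_def \<tau>_def block_swap_block_swap block_swap_less)
  then have "emeasure (uniform_measure (matrix_lborel m) (block_polytope m)) ?E' =
      emeasure (uniform_measure (matrix_lborel m) (block_polytope m)) ?E"
    using E sets_block_polytope[of m] by (simp add: sets_matrix_lborel)
  then show ?thesis
    unfolding measure_def by simp
qed

text \<open>\<open>Hoeffding_transfer\<close> for the \<open>(m div k)\<^sup>2\<close> disjoint
  blocks. The right side does not depend on \<open>B\<close>, so it will also bound the supremum
  over all events.\<close>

lemma scaled_block_total_variation:
  assumes m: "k \<ge> 1" "k \<le> m" and B: "B \<in> sets (matrix_borel k)" and \<epsilon>: "\<epsilon> \<ge> 0"
    and R: "prob_space (uniform_measure (matrix_lborel m) (block_polytope m))"
  shows "\<bar>measure (uniform_measure (matrix_lborel m) (block_polytope m))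
        (scaled_block k (real m + 1) 0 0 -` B \<inter> space (matrix_borel m)) -
      measure (exponential_matrix_law k 1) B\<bar> \<le>
    \<epsilon> + density_bound m * (2 * exp (- 2 * real (m div k) ^ 2 * \<epsilon>\<^sup>2))"
proof -
  let ?R = "uniform_measure (matrix_lborel m) (block_polytope m)"
  let ?l = "real m + 1"
  let ?M = "exponential_matrix_law m ?l"
  let ?I = "matrix_index (m div k)"
  let ?E = "\<lambda>ab. (\<lambda>A. scaled_block k ?l (fst ab) (snd ab) A) -` B \<inter> space (matrix_borel m)"
  interpret prob_space ?M by (rule prob_space_exponential_matrix_law) simp
  interpret R: prob_space ?R by (rule R)
  have q: "m div k > 0" using m by (simp add: div_greater_zero_iff)
  have E: "?E ab \<in> sets (matrix_borel m)" if "ab \<in> ?I" for ab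
  proof -
    have "fst ab < m div k" "snd ab < m div k"
      using that by (auto simp: matrix_index_def)
    from measurable_sets[OF measurable_scaled_block[OF this] B] show ?thesis .
  qed
  have K: "density_bound m \<ge> 0" unfolding density_bound_def by simp
  have "\<bar>measure ?R (scaled_block k ?l 0 0 -` B \<inter> space (matrix_borel m)) -
      measure (exponential_matrix_law k 1) B\<bar> \<le>
    \<epsilon> + density_bound m * (2 * exp (- 2 * real (card ?I) * \<epsilon>\<^sup>2))"
  proof (rule Hoeffding_transfer[where R = ?R and I = ?I and E = ?E])
    show "sets ?R = sets ?M"
      by (simp add: sets_exponential_matrix_law sets_matrix_lborel)
    show "measure ?R A \<le> density_bound m * prob A" if "A \<in> sets ?M" for A
    proof -
      have "emeasure ?R A \<le> ennreal (density_bound m) * emeasure ?M A"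
        using that m by (intro uniform_block_polytope_le_exponential) (auto simp: sets_exponential_matrix_law)
      then have "ennreal (measure ?R A) \<le> ennreal (density_bound m * prob A)"
        using K by (simp add: R.emeasure_eq_measure emeasure_eq_measure ennreal_mult)
      then show ?thesis
        using K by (subst (asm) ennreal_le_iff) auto
    qed
    show "?I \<noteq> {}" using q by (auto simp: matrix_index_def lessThan_empty_iff)
    show "indep_vars (\<lambda>_. borel) (\<lambda>ab. indicator (?E ab) :: _ \<Rightarrow> real) ?I"
      by (rule indep_vars_scaled_block) (use m B in auto)
    show "prob (?E ab) = measure (exponential_matrix_law k 1) B" if "ab \<in> ?I" for ab
    proof -
      have ab: "fst ab < m div k" "snd ab < m div k"
        using that by (auto simp: matrix_index_def)
      have "scaled_block k ?l (fst ab) (snd ab) \<in> measurable ?M (matrix_borel k)"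
        using measurable_scaled_block[OF ab] by (simp cong: measurable_cong_sets add: sets_exponential_matrix_law)
      from measure_distr[OF this B] show ?thesis
        by (simp add: distr_scaled_block[OF ab] space_exponential_matrix_law)
    qed
    show "measure ?R (?E ab) = measure ?R (scaled_block k ?l 0 0 -` B \<inter> space (matrix_borel m))"
      if "ab \<in> ?I" for ab
      using that by (intro measure_uniform_scaled_block B) (auto simp: matrix_index_def)
  qed (use R \<epsilon> K E in \<open>auto simp: sets_exponential_matrix_law\<close>)
  also have "real (card ?I) = real (m div k) ^ 2"
    by (simp add: matrix_index_def card_cartesian_product power2_eq_square)
  finally show ?thesis .
qed

subsection \<open>The total variation estimate\<close>

lemma distr_iid_exponential_matrix:
  assumes D: "iid_exponential_matrix k M D" and k: "k \<ge> 1"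
  shows "distr M (matrix_borel k) D = exponential_matrix_law k 1"
proof -
  interpret prob_space M using D by (simp add: iid_exponential_matrix_def)
  have D_meas: "D \<in> measurable M (matrix_borel k)"
    and indep: "indep_vars (\<lambda>_. borel) (\<lambda>ij \<omega>. D \<omega> ij) (matrix_index k)"
    and exp: "\<And>ij. ij \<in> matrix_index k \<Longrightarrow> distributed M lborel (\<lambda>\<omega>. D \<omega> ij) (exponential_density 1)"
    using D by (auto simp: iid_exponential_matrix_def)
  have ne: "matrix_index k \<noteq> {}"
    using k by (auto simp: matrix_index_def lessThan_empty_iff)
  have rv: "(\<lambda>\<omega>. D \<omega> ij) \<in> borel_measurable M" if "ij \<in> matrix_index k" for ij
    using measurable_compose[OF D_meas measurable_component_singleton[OF that]] .
  have "distr M (matrix_borel k) D = distr M (matrix_borel k) (\<lambda>\<omega>. \<lambda>ij\<in>matrix_index k. D \<omega> ij)"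
    using measurable_space[OF D_meas]
    by (intro distr_cong) (auto simp: space_matrix_borel extensional_restrict)
  also have "\<dots> = PiM (matrix_index k) (\<lambda>ij. distr M borel (\<lambda>\<omega>. D \<omega> ij))"
    using indep_vars_iff_distr_eq_PiM'[where X = "\<lambda>ij \<omega>. D \<omega> ij" and M' = "\<lambda>_. borel", OF ne rv] indep
    by blast
  also have "\<dots> = exponential_matrix_law k 1"
  proof (intro PiM_cong refl)
    fix ij assume "ij \<in> matrix_index k"
    then have "distr M lborel (\<lambda>\<omega>. D \<omega> ij) = exponential_law 1"
      using exp by (auto simp: distributed_def)
    moreover have "distr M borel (\<lambda>\<omega>. D \<omega> ij) = distr M lborel (\<lambda>\<omega>. D \<omega> ij)"
      by (intro distr_cong) auto
    ultimately show "distr M borel (\<lambda>\<omega>. D \<omega> ij) = exponential_law 1" by simp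
  qed
  finally show ?thesis .
qed

text \<open>For \<open>k \<le> m\<close> the corner lies inside the block of order \<open>m\<close>,
  whose law is prescribed. That law is the distribution of a random matrix, which is why the
  normalized measure is a probability measure.\<close>

lemma measure_scaled_corner:
  assumes X: "uniform_doubly_stochastic (Suc m) M X" and k: "1 \<le> k" "k \<le> m"
    and B: "B \<in> sets (matrix_borel k)"
  shows "measure (distr M (matrix_borel k) (\<lambda>\<omega>. scale_matrix k (real (Suc m)) (upper_left_block k (X \<omega>)))) B =
    measure (uniform_measure (matrix_lborel m) (block_polytope m))
      (scaled_block k (real m + 1) 0 0 -` B \<inter> space (matrix_borel m))"
    and "prob_space (uniform_measure (matrix_lborel m) (block_polytope m))"
proof -
  let ?U = "uniform_measure (matrix_lborel m) (block_polytope m)"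
  let ?s = "scaled_block k (real m + 1) 0 0"
  interpret prob_space M using X by (simp add: uniform_doubly_stochastic_def)
  have X_meas: "X \<in> measurable M (matrix_borel (Suc m))"
    and U: "distr M (matrix_lborel m) (\<lambda>\<omega>. upper_left_block m (X \<omega>)) = ?U"
    using X by (auto simp: uniform_doubly_stochastic_def block_image_birkhoff_polytope)
  have mono: "matrix_index m \<subseteq> matrix_index (Suc m)" "matrix_index k \<subseteq> matrix_index m"
    using k by (auto simp: matrix_index_def)
  have "(\<lambda>\<omega>. upper_left_block m (X \<omega>)) \<in> measurable M (matrix_borel m)"
    unfolding upper_left_block_def
    by (rule measurable_compose[OF X_meas measurable_restrict_subset[OF mono(1)]])
  then have Y: "(\<lambda>\<omega>. upper_left_block m (X \<omega>)) \<in> measurable M (matrix_lborel m)"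
    by (simp add: sets_matrix_lborel cong: measurable_cong_sets)
  have "0 < m div k" using k by (simp add: div_greater_zero_iff)
  then have s: "?s \<in> measurable (matrix_lborel m) (matrix_borel k)"
    using measurable_scaled_block[of 0 m k 0] by (simp add: sets_matrix_lborel cong: measurable_cong_sets)
  have "scale_matrix k (real (Suc m)) (upper_left_block k A) = ?s (upper_left_block m A)"
    for A :: "nat \<times> nat \<Rightarrow> real"
    unfolding scale_matrix_def scaled_block_def upper_left_block_def
    using mono(2) by (intro restrict_ext) (auto simp: add.commute)
  then have "distr M (matrix_borel k) (\<lambda>\<omega>. scale_matrix k (real (Suc m)) (upper_left_block k (X \<omega>))) =
      distr M (matrix_borel k) (?s \<circ> (\<lambda>\<omega>. upper_left_block m (X \<omega>)))"
    by (simp add: comp_def)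
  also have "\<dots> = distr ?U (matrix_borel k) ?s"
    unfolding U[symmetric] by (rule distr_distr[OF s Y, symmetric])
  finally have "distr M (matrix_borel k) (\<lambda>\<omega>. scale_matrix k (real (Suc m)) (upper_left_block k (X \<omega>))) =
      distr ?U (matrix_borel k) ?s" .
  moreover have "?s \<in> measurable ?U (matrix_borel k)"
    using s by (simp cong: measurable_cong_sets)
  moreover have "space ?U = space (matrix_borel m)"
    by (simp add: space_PiM)
  ultimately show "measure (distr M (matrix_borel k)
       (\<lambda>\<omega>. scale_matrix k (real (Suc m)) (upper_left_block k (X \<omega>)))) B =
    measure ?U (?s -` B \<inter> space (matrix_borel m))"
    using B by (simp add: measure_distr)
  show "prob_space ?U"
    unfolding U[symmetric] by (rule prob_space_distr[OF Y])
qed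

lemma tv_dist_scaled_corner_le:
  assumes X: "uniform_doubly_stochastic (Suc m) M X" and k: "1 \<le> k" "k \<le> m"
    and D: "iid_exponential_matrix k N D" and \<epsilon>: "\<epsilon> \<ge> 0"
  defines "t \<equiv> tv_dist
     (distr M (matrix_borel k) (\<lambda>\<omega>. scale_matrix k (real (Suc m)) (upper_left_block k (X \<omega>))))
     (distr N (matrix_borel k) D)"
  shows "0 \<le> t" "t \<le> \<epsilon> + density_bound m * (2 * exp (- 2 * real (m div k) ^ 2 * \<epsilon>\<^sup>2))"
proof -
  let ?\<mu> = "distr M (matrix_borel k) (\<lambda>\<omega>. scale_matrix k (real (Suc m)) (upper_left_block k (X \<omega>)))"
  let ?\<nu> = "distr N (matrix_borel k) D"
  let ?b = "\<epsilon> + density_bound m * (2 * exp (- 2 * real (m div k) ^ 2 * \<epsilon>\<^sup>2))"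
  have bound: "\<bar>measure ?\<mu> B - measure ?\<nu> B\<bar> \<le> ?b" if "B \<in> sets ?\<mu>" for B
    using that k scaled_block_total_variation[OF k _ \<epsilon>, of B] measure_scaled_corner[OF X k, of B]
    by (simp add: distr_iid_exponential_matrix[OF D k(1)])
  then have bdd: "bdd_above ((\<lambda>B. \<bar>measure ?\<mu> B - measure ?\<nu> B\<bar>) ` sets ?\<mu>)"
    by (intro bdd_aboveI2)
  \<comment> \<open>The empty event gives the value 0; boundedness is needed for a real supremum to
    dominate it.\<close>
  have "0 \<le> \<bar>measure ?\<mu> {} - measure ?\<nu> {}\<bar>" by simp
  also have "\<dots> \<le> t"
    unfolding t_def tv_dist_def by (rule cSUP_upper[OF _ bdd]) simp
  finally show "0 \<le> t" .
  show "t \<le> ?b"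
    unfolding t_def tv_dist_def using bound by (intro cSUP_least) auto
qed

section \<open>Asymptotics of the domination factor and the block count\<close>

text \<open>With \<open>n = m + 1\<close> the base \<open>m ^ 3 * (m ^ 2 + 1)\<close> is at most
  \<open>n ^ 5\<close>, and \<open>(n ^ 5) ^ n = exp (5 * n * ln n)\<close>.\<close>

lemma density_bound_le:
  assumes "m \<ge> 1"
  shows "density_bound m \<le> exp (2 * real (Suc m) + 5 * real (Suc m) * ln (real (Suc m)))"
proof -
  define n where "n = real (Suc m)"
  have n: "n \<ge> 1" "real m \<le> n" by (simp_all add: n_def)
  have "real m ^ 2 + 1 \<le> n ^ 2"
    by (simp add: n_def power2_eq_square algebra_simps)
  then have "real m ^ 3 * (real m ^ 2 + 1) \<le> n ^ 3 * n ^ 2"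
    using n by (intro mult_mono power_mono) auto
  then have "(real m ^ 3 * (real m ^ 2 + 1)) ^ m \<le> (n ^ 5) ^ m"
    by (intro power_mono) (auto simp flip: power_add)
  also have "\<dots> \<le> (n ^ 5) ^ Suc m"
    using n by (intro power_increasing) auto
  also have "\<dots> = exp (5 * n * ln n)"
  proof -
    have "exp (5 * n * ln n) = exp (real (5 * Suc m) * ln n)"
      by (simp add: n_def)
    also have "\<dots> = exp (ln n) ^ (5 * Suc m)"
      by (rule exp_of_nat_mult)
    also have "exp (ln n) = n"
      using n by simp
    finally show ?thesis by (simp only: power_mult)
  qed
  finally have "density_bound m \<le> exp (2 * n) * exp (5 * n * ln n)"
    unfolding density_bound_def using n by (intro mult_mono) auto
  then show ?thesis by (simp add: exp_add n_def)
qed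

text \<open>Write \<open>n = m + 1\<close> and \<open>q = m div k\<close>. Since
  \<open>k \<le> n / 2 - 1\<close>, the incomplete block costs little:
  \<open>q * k > m - k \<ge> n / 2\<close>. Inserting the growth bound on \<open>k\<close> gives
  \<open>2 * c * q \<ge> sqrt n * ln n\<close>, which is then squared.\<close>

lemma block_count_lower_bound:
  fixes k m :: nat and c :: real
  assumes k: "1 \<le> k" "real k \<le> c * (sqrt (real (Suc m)) / ln (real (Suc m)))"
    and small: "c * (sqrt (real (Suc m)) / ln (real (Suc m))) \<le> real (Suc m) / 2 - 1"
    and m: "m \<ge> 1" and c: "c > 0"
  shows "k \<le> m" "real (Suc m) * ln (real (Suc m)) ^ 2 / (4 * c\<^sup>2) \<le> real (m div k) ^ 2"
proof -
  define n where "n = real (Suc m)"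
  define q where "q = m div k"
  have n: "n > 1" "ln n > 0" "real m = n - 1" using m by (simp_all add: n_def)
  have kn: "real k \<le> n / 2 - 1" using k small unfolding n_def by linarith
  then show "k \<le> m" using n by linarith
  have "real m < real (q * k + k)"
    unfolding q_def of_nat_less_iff using dividend_less_div_times[of k m] k by (simp add: add.commute)
  then have "n / 2 \<le> real q * real k"
    using kn n by simp
  also have "\<dots> \<le> real q * (c * (sqrt n / ln n))"
    using k unfolding n_def by (intro mult_left_mono) auto
  finally have le: "n * ln n \<le> 2 * c * real q * sqrt n"
    using n by (simp add: field_simps)
  have "sqrt n * (sqrt n * ln n) = n * ln n"
    using n by (simp flip: mult.assoc)
  also note le
  also have "2 * c * real q * sqrt n = sqrt n * (2 * c * real q)"
    by simp
  finally have "sqrt n * (sqrt n * ln n) \<le> sqrt n * (2 * c * real q)" .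
  then have "sqrt n * ln n \<le> 2 * c * real q"
    using n by (subst (asm) mult_le_cancel_left_pos) auto
  then have "(sqrt n * ln n)\<^sup>2 \<le> (2 * c * real q)\<^sup>2"
    using n by (intro power_mono) auto
  then have "n * (ln n)\<^sup>2 \<le> 4 * c\<^sup>2 * (real q)\<^sup>2"
    using n by (simp add: power_mult_distrib)
  then show "real (Suc m) * ln (real (Suc m)) ^ 2 / (4 * c\<^sup>2) \<le> real (m div k) ^ 2"
    using c unfolding n_def[symmetric] q_def[symmetric] by (simp add: field_simps)
qed

theorem theorem4:
  fixes k :: "nat \<Rightarrow> nat"
    and M :: "nat \<Rightarrow> 'a measure" and X :: "nat \<Rightarrow> 'a \<Rightarrow> nat \<times> nat \<Rightarrow> real"
    and N :: "nat \<Rightarrow> 'b measure" and \<Delta> :: "nat \<Rightarrow> 'b \<Rightarrow> nat \<times> nat \<Rightarrow> real"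
    and V :: "nat \<Rightarrow> 'a \<Rightarrow> nat \<times> nat \<Rightarrow> real"
  assumes k_bounds: "\<And>n. n \<ge> 1 \<Longrightarrow> 1 \<le> k n \<and> k n \<le> n"
    and k_growth: "(\<lambda>n. real (k n)) \<in> O(\<lambda>n. sqrt (real n) / ln (real n))"
    and X: "\<And>n. n \<ge> 1 \<Longrightarrow> uniform_doubly_stochastic n (M n) (X n)"
    and V: "\<And>n \<omega>. V n \<omega> = upper_left_block (k n) (X n \<omega>)"
    and \<Delta>: "\<And>n. n \<ge> 1 \<Longrightarrow> iid_exponential_matrix (k n) (N n) (\<Delta> n)"
  shows "(\<lambda>n. tv_dist
            (distr (M n) (matrix_borel (k n)) (\<lambda>\<omega>. scale_matrix (k n) (real n) (V n \<omega>)))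
            (distr (N n) (matrix_borel (k n)) (\<Delta> n))) \<longlonglongrightarrow> 0"
proof (rule LIMSEQ_I)
  fix e :: real assume e: "e > 0"
  define t where "t = (\<lambda>n. tv_dist
            (distr (M n) (matrix_borel (k n)) (\<lambda>\<omega>. scale_matrix (k n) (real n) (V n \<omega>)))
            (distr (N n) (matrix_borel (k n)) (\<Delta> n)))"
  \<comment> \<open>One half of \<open>e\<close> is allotted to the deviation of the average, the
    other to the transferred Hoeffding tail.\<close>
  define \<epsilon> where "\<epsilon> = e / 2"
  have \<epsilon>: "\<epsilon> > 0" using e by (simp add: \<epsilon>_def)
  obtain c where c: "c > 0"
    and k_le: "\<forall>\<^sub>F n in sequentially. norm (real (k n)) \<le> c * norm (sqrt (real n) / ln (real n))"
    using k_growth by (elim landau_o.bigE)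
  \<comment> \<open>With this \<open>d\<close>, the block count makes the Hoeffding exponent
    \<open>2 * \<epsilon>\<^sup>2 * (m div k)\<^sup>2\<close> at least
    \<open>d * n * (ln n)\<^sup>2\<close>.\<close>
  define d where "d = \<epsilon>\<^sup>2 / (2 * c\<^sup>2)"
  have d: "d > 0" using \<epsilon> c by (simp add: d_def)
  \<comment> \<open>The gain of order \<open>n * (ln n)\<^sup>2\<close> eventually exceeds the loss
    of order \<open>n * ln n\<close>, however small \<open>d\<close> is.\<close>
  have "((\<lambda>n. 2 * exp (2 * real n + 5 * real n * ln (real n) - d * (real n * ln (real n) ^ 2))) \<longlongrightarrow> 0) sequentially"
    using d by real_asymp
  then have small: "\<forall>\<^sub>F n in sequentially.
      2 * exp (2 * real n + 5 * real n * ln (real n) - d * (real n * ln (real n) ^ 2)) < \<epsilon>"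
    using \<epsilon> by (rule order_tendstoD)
  have half: "\<forall>\<^sub>F n in sequentially. c * (sqrt (real n) / ln (real n)) \<le> real n / 2 - 1"
    using c by real_asymp
  have "\<forall>\<^sub>F n in sequentially. norm (t n - 0) < e"
    using k_le small half eventually_ge_at_top[of 2]
  proof eventually_elim
    case (elim n)
    then obtain m where n: "n = Suc m" and m: "m \<ge> 1"
      by (cases n) auto
    have "ln (real n) > 0" using elim by simp
    then have k: "1 \<le> k n" "real (k n) \<le> c * (sqrt (real (Suc m)) / ln (real (Suc m)))"
      using elim k_bounds[of n] by (auto simp: n)
    have small': "c * (sqrt (real (Suc m)) / ln (real (Suc m))) \<le> real (Suc m) / 2 - 1"
      using elim by (simp add: n)
    note q = block_count_lower_bound[OF k small' m c]
    have Xn: "uniform_doubly_stochastic (Suc m) (M n) (X n)" and Dn: "iid_exponential_matrix (k n) (N n) (\<Delta> n)"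
      using X[of n] \<Delta>[of n] by (simp_all add: n)
    have t: "t n = tv_dist
     (distr (M n) (matrix_borel (k n)) (\<lambda>\<omega>. scale_matrix (k n) (real (Suc m)) (upper_left_block (k n) (X n \<omega>))))
     (distr (N n) (matrix_borel (k n)) (\<Delta> n))"
      unfolding t_def V by (simp add: n)
    have "density_bound m * (2 * exp (- 2 * real (m div k n) ^ 2 * \<epsilon>\<^sup>2)) \<le>
        exp (2 * real n + 5 * real n * ln (real n)) * (2 * exp (- d * (real n * ln (real n) ^ 2)))"
    proof (intro mult_mono density_bound_le[OF m, folded n])
      have "d * (real n * ln (real n) ^ 2) = 2 * (real n * ln (real n) ^ 2 / (4 * c\<^sup>2)) * \<epsilon>\<^sup>2"
        using c by (simp add: d_def field_simps)
      also have "\<dots> \<le> 2 * real (m div k n) ^ 2 * \<epsilon>\<^sup>2"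
        using q(2) by (intro mult_right_mono mult_left_mono) (auto simp: n)
      finally show "exp (- 2 * real (m div k n) ^ 2 * \<epsilon>\<^sup>2) \<le> exp (- d * (real n * ln (real n) ^ 2))"
        by simp
    qed auto
    also have "\<dots> = 2 * exp (2 * real n + 5 * real n * ln (real n) - d * (real n * ln (real n) ^ 2))"
      by (simp add: exp_diff exp_minus field_simps)
    also have "\<dots> < \<epsilon>" using elim by simp
    finally have "density_bound m * (2 * exp (- 2 * real (m div k n) ^ 2 * \<epsilon>\<^sup>2)) < \<epsilon>" .
    then have "t n < e"
      using tv_dist_scaled_corner_le(2)[OF Xn k(1) q(1) Dn less_imp_le[OF \<epsilon>]] unfolding t \<epsilon>_def by linarith
    moreover have "0 \<le> t n"
      using tv_dist_scaled_corner_le(1)[OF Xn k(1) q(1) Dn less_imp_le[OF \<epsilon>]] unfolding t .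
    ultimately show ?case by simp
  qed
  then show "\<exists>no. \<forall>n\<ge>no. norm (tv_dist
            (distr (M n) (matrix_borel (k n)) (\<lambda>\<omega>. scale_matrix (k n) (real n) (V n \<omega>)))
            (distr (N n) (matrix_borel (k n)) (\<Delta> n)) - 0) < e"
    unfolding t_def eventually_sequentially .
qed

end
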